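(* Let $m\ge1$, let $V$ be an $(m+1)$-dimensional complex vector space and $V'\subset V$ an $m$-dimensional subspace. Choose a basis of $V'$, extend it to a basis of $V$, and embed $\mathrm{GL}(m,\mathbb C)=\mathrm{GL}(V')$ into $\mathrm{SL}(m+1,\mathbb C)=\mathrm{SL}(V)$ by $$f: g\mapsto \begin{pmatrix} g & 0\\ 0 & \det(g)^{-1}\end{pmatrix}.$$ Let $G'$ be a finite subgroup of $\mathrm{GL}(V')$ and let $G=f(G')\subset\mathrm{SL}(V)$. Then the McKay quiver $Q_G$ of $G$ (formed with the representation $V$) is obtained from the McKay quiver $Q_{G'}$ of $G'$ (formed with the representation $V'$) by adding one arrow from $\sigma i$ to $i$ for each vertex $i\in Q_{G',0}$, where $\sigma$ is the Nakayama translation on $Q_{G',0}$ (and the vertices of $Q_G$ and $Q_{G'}$ are identified via the isomorphism $f:G'\to G$).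
   Context: McKay quiver: for a finite subgroup $H$ of $\mathrm{GL}(W)$, $W$ a finite-dimensional complex vector space, let $S_1,\dots,S_n$ be representatives of the isomorphism classes of irreducible complex representations of $H$, and write $W\otimes S_i\cong\bigoplus_j a_{i,j}S_j$ ($a_{i,j}$ copies of $S_j$). The McKay quiver $Q_H$ has vertex set $Q_{H,0}=\{1,\dots,n\}$ and $a_{i,j}$ arrows from $i$ to $j$. Nakayama translation: let $\wedge W$ be the exterior algebra of $W$ and $\wedge W*H$ the skew group algebra for the natural action of $H$. It is a finite-dimensional selfinjective graded algebra whose quiver is the McKay quiver $Q_H$; its simple modules correspond to the irreducible representations of $H$. The Nakayama translation $\sigma$ is the permutation of $Q_{H,0}$ such that $\sigma i$ is the vertex of the simple module which is the socle of the projective cover of the simple module associated to $i$. In the theorem, $\sigma$ is taken for $H=G'$, $W=V'$. *)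

theory Defs
  imports
    "Jordan_Normal_Form.VS_Connect"
    "Graph_Theory.Digraph_Isomorphism"
begin

text \<open>Finite-dimensional complex vector spaces are the coordinate spaces \<open>carrier_vec d\<close>, so that
  representations and modules are matrix valued. One record serves both for representations of a
  group and for left modules over a complex algebra: \<open>'x\<close> is the type of the elements that act, and
  the set \<open>X\<close> below is the carrier of the group or algebra.\<close>

record 'x rep =
  deg :: nat
  act :: "'x \<Rightarrow> complex mat"

definition intertwiners :: "'x set \<Rightarrow> 'x rep \<Rightarrow> 'x rep \<Rightarrow> complex mat set" where
  "intertwiners X M N =
    {T \<in> carrier_mat (deg N) (deg M). \<forall>x\<in>X. T * act M x = act N x * T}"

definition rep_iso :: "'x set \<Rightarrow> 'x rep \<Rightarrow> 'x rep \<Rightarrow> bool" where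
  "rep_iso X M N \<longleftrightarrow> (\<exists>T \<in> intertwiners X M N. invertible_mat T)"

definition subrep :: "'x set \<Rightarrow> 'x rep \<Rightarrow> complex vec set \<Rightarrow> bool" where
  "subrep X M U \<longleftrightarrow>
    VectorSpace.subspace class_ring U (module_vec TYPE(complex) (deg M)) \<and>
    (\<forall>x\<in>X. \<forall>u\<in>U. act M x *\<^sub>v u \<in> U)"

definition simple_rep :: "'x set \<Rightarrow> 'x rep \<Rightarrow> bool" where
  "simple_rep X M \<longleftrightarrow> deg M > 0 \<and>
    (\<forall>U. subrep X M U \<longrightarrow> U = {0\<^sub>v (deg M)} \<or> U = carrier_vec (deg M))"

definition simple_subrep :: "'x set \<Rightarrow> 'x rep \<Rightarrow> complex vec set \<Rightarrow> bool" where
  "simple_subrep X M U \<longleftrightarrow> subrep X M U \<and> U \<noteq> {0\<^sub>v (deg M)} \<and>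
    (\<forall>U'. subrep X M U' \<and> U' \<subseteq> U \<longrightarrow> U' = {0\<^sub>v (deg M)} \<or> U' = U)"

definition socle :: "'x set \<Rightarrow> 'x rep \<Rightarrow> complex vec set" where
  "socle X M = LinearCombinations.module.span class_ring (module_vec TYPE(complex) (deg M))
    (\<Union>{U. simple_subrep X M U})"


subsection \<open>Group representations\<close>

definition GL :: "nat \<Rightarrow> complex mat monoid" where
  "GL n = units_of (ring_mat TYPE(complex) n ())"

abbreviation GL_sub :: "nat \<Rightarrow> complex mat set \<Rightarrow> complex mat monoid" where
  "GL_sub n H \<equiv> (GL n)\<lparr>carrier := H\<rparr>"

definition group_rep :: "('g, 'b) monoid_scheme \<Rightarrow> 'g rep \<Rightarrow> bool" where
  "group_rep G M \<longleftrightarrow> act M \<in> hom G (GL (deg M))"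

definition irrep_representatives ::
    "('g, 'b) monoid_scheme \<Rightarrow> nat \<Rightarrow> (nat \<Rightarrow> 'g rep) \<Rightarrow> bool" where
  "irrep_representatives G n S \<longleftrightarrow>
    (\<forall>i<n. group_rep G (S i) \<and> simple_rep (carrier G) (S i)) \<and>
    (\<forall>i<n. \<forall>j<n. rep_iso (carrier G) (S i) (S j) \<longrightarrow> i = j) \<and>
    (\<forall>M. group_rep G M \<and> simple_rep (carrier G) M \<longrightarrow> (\<exists>i<n. rep_iso (carrier G) M (S i)))"

definition natural_rep :: "nat \<Rightarrow> complex mat rep" where
  "natural_rep m = \<lparr>deg = m, act = (\<lambda>g. g)\<rparr>"

definition kronecker :: "complex mat \<Rightarrow> complex mat \<Rightarrow> complex mat" where
  "kronecker A B = mat (dim_row A * dim_row B) (dim_col A * dim_col B)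
    (\<lambda>(i, j). A $$ (i div dim_row B, j div dim_col B) * B $$ (i mod dim_row B, j mod dim_col B))"

definition tensor_rep :: "'g rep \<Rightarrow> 'g rep \<Rightarrow> 'g rep" where
  "tensor_rep M N = \<lparr>deg = deg M * deg N, act = (\<lambda>g. kronecker (act M g) (act N g))\<rparr>"

text \<open>The direct sum of \<open>a j\<close> copies of \<open>S j\<close>, over all \<open>j < n\<close>.\<close>

definition sum_rep :: "nat \<Rightarrow> (nat \<Rightarrow> nat) \<Rightarrow> (nat \<Rightarrow> 'g rep) \<Rightarrow> 'g rep" where
  "sum_rep n a S =
    \<lparr>deg = (\<Sum>j<n. a j * deg (S j)),
     act = (\<lambda>g. diag_block_mat (concat (map (\<lambda>j. replicate (a j) (act (S j) g)) [0..<n])))\<rparr>"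


subsection \<open>McKay quivers\<close>

text \<open>A McKay quiver is determined up to renaming its arrows. The vertices are
  \<open>0, \<dots>, n - 1\<close>, where \<open>S 0, \<dots>, S (n - 1)\<close> represent the irreducible representations of \<open>H\<close>.\<close>

definition mckay_quiver ::
    "nat \<Rightarrow> complex mat set \<Rightarrow> nat \<Rightarrow> (nat \<Rightarrow> complex mat rep) \<Rightarrow> (nat, 'a) pre_digraph \<Rightarrow> bool" where
  "mckay_quiver m H n S Q \<longleftrightarrow> fin_digraph Q \<and> verts Q = {..<n} \<and>
    (\<forall>i<n. rep_iso H (tensor_rep (natural_rep m) (S i))
      (sum_rep n (\<lambda>j. card {e \<in> arcs Q. tail Q e = i \<and> head Q e = j}) S))"

text \<open>One new arrow \<open>Inr i\<close> from \<open>\<sigma> i\<close> to \<open>i\<close> for each vertex \<open>i\<close>.\<close>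

definition add_arrows :: "('v \<Rightarrow> 'v) \<Rightarrow> ('v, 'a) pre_digraph \<Rightarrow> ('v, 'a + 'v) pre_digraph" where
  "add_arrows \<sigma> Q =
    \<lparr>verts = verts Q, arcs = Inl ` arcs Q \<union> Inr ` verts Q,
     tail = case_sum (tail Q) \<sigma>, head = case_sum (head Q) (\<lambda>i. i)\<rparr>"

definition quiver_iso_over_verts :: "('v, 'a) pre_digraph \<Rightarrow> ('v, 'b) pre_digraph \<Rightarrow> bool" where
  "quiver_iso_over_verts Q R \<longleftrightarrow>
    (\<exists>\<phi>. pre_digraph.digraph_isomorphism Q \<phi> \<and> (\<forall>v\<in>verts Q. iso_verts \<phi> v = v) \<and>
      R = app_iso \<phi> Q)"


subsection \<open>Modules over a finite-dimensional algebra\<close>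

text \<open>A (not necessarily commutative) complex algebra is given by a \<open>module\<close> record, which carries
  ring operations and a scalar multiplication.\<close>

definition alg_module :: "(complex, 'x) module \<Rightarrow> 'x rep \<Rightarrow> bool" where
  "alg_module A M \<longleftrightarrow> act M \<in> Ring.ring_hom A (ring_mat TYPE(complex) (deg M) ()) \<and>
    (\<forall>c. \<forall>x\<in>carrier A. act M (c \<odot>\<^bsub>A\<^esub> x) = c \<cdot>\<^sub>m act M x)"

definition surjective_mat :: "complex mat \<Rightarrow> bool" where
  "surjective_mat T \<longleftrightarrow> (\<lambda>v. T *\<^sub>v v) ` carrier_vec (dim_col T) = carrier_vec (dim_row T)"

text \<open>Projectivity in the category of finite-dimensional \<open>A\<close>-modules; over a finite-dimensional
  algebra this agrees with projectivity among all modules.\<close>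

definition projective_module :: "(complex, 'x) module \<Rightarrow> 'x rep \<Rightarrow> bool" where
  "projective_module A P \<longleftrightarrow> alg_module A P \<and>
    (\<forall>M N. alg_module A M \<and> alg_module A N \<longrightarrow>
      (\<forall>g \<in> intertwiners (carrier A) M N. \<forall>h \<in> intertwiners (carrier A) P N.
        surjective_mat g \<longrightarrow> (\<exists>k \<in> intertwiners (carrier A) P M. g * k = h)))"

text \<open>The last condition says that \<open>\<pi>\<close> is an essential epimorphism, i.e. has superfluous kernel.\<close>

definition projective_cover :: "(complex, 'x) module \<Rightarrow> 'x rep \<Rightarrow> complex mat \<Rightarrow> 'x rep \<Rightarrow> bool" where
  "projective_cover A P \<pi> M \<longleftrightarrow> projective_module A P \<and>
    \<pi> \<in> intertwiners (carrier A) P M \<and> surjective_mat \<pi> \<and>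
    (\<forall>U. subrep (carrier A) P U \<and> (\<lambda>v. \<pi> *\<^sub>v v) ` U = carrier_vec (deg M) \<longrightarrow>
      U = carrier_vec (deg P))"

definition socle_iso :: "(complex, 'x) module \<Rightarrow> 'x rep \<Rightarrow> 'x rep \<Rightarrow> bool" where
  "socle_iso A P T \<longleftrightarrow> (\<exists>t \<in> intertwiners (carrier A) T P.
    bij_betw (\<lambda>v. t *\<^sub>v v) (carrier_vec (deg T)) (socle (carrier A) P))"

text \<open>\<open>T i\<close>, for \<open>i < n\<close>, is the simple module associated to the vertex \<open>i\<close>.\<close>

definition nakayama_translation ::
    "(complex, 'x) module \<Rightarrow> nat \<Rightarrow> (nat \<Rightarrow> 'x rep) \<Rightarrow> (nat \<Rightarrow> nat) \<Rightarrow> bool" where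
  "nakayama_translation A n T \<sigma> \<longleftrightarrow> bij_betw \<sigma> {..<n} {..<n} \<and>
    (\<forall>i<n. \<exists>P \<pi>. projective_cover A P \<pi> (T i) \<and> socle_iso A P (T (\<sigma> i)))"


subsection \<open>The exterior algebra and the skew group algebra\<close>

text \<open>The exterior algebra of the space with basis \<open>e 0, \<dots>, e (m - 1)\<close>: the function \<open>a\<close> stands for
  the sum over \<open>I \<subseteq> {..<m}\<close> of \<open>a I\<close> times the wedge product of the \<open>e i\<close>, \<open>i \<in> I\<close>, in increasing
  order. The sign of the product of the basis elements of disjoint \<open>I\<close>, \<open>J\<close> counts inversions.\<close>

definition ext_sign :: "nat set \<Rightarrow> nat set \<Rightarrow> complex" where
  "ext_sign I J = (- 1) ^ card {(i, j). i \<in> I \<and> j \<in> J \<and> j < i}"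

definition ext_mult :: "(nat set \<Rightarrow> complex) \<Rightarrow> (nat set \<Rightarrow> complex) \<Rightarrow> nat set \<Rightarrow> complex" where
  "ext_mult a b K = (\<Sum>I\<in>Pow K. ext_sign I (K - I) * a I * b (K - I))"

definition ext_one :: "nat set \<Rightarrow> complex" where
  "ext_one I = (if I = {} then 1 else 0)"

definition ext_algebra :: "nat \<Rightarrow> (complex, nat set \<Rightarrow> complex) module" where
  "ext_algebra m =
    \<lparr>carrier = {a. \<forall>I. a I \<noteq> 0 \<longrightarrow> I \<subseteq> {..<m}},
     monoid.mult = ext_mult, one = ext_one,
     zero = (\<lambda>_. 0), add = (\<lambda>a b I. a I + b I), smult = (\<lambda>c a I. c * a I)\<rparr>"

definition ext_vec :: "complex vec \<Rightarrow> nat set \<Rightarrow> complex" where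
  "ext_vec v I = (\<Sum>i<dim_vec v. if I = {i} then v $ i else 0)"

text \<open>The action \<open>g (w\<^sub>1 \<and> \<dots> \<and> w\<^sub>k) = g w\<^sub>1 \<and> \<dots> \<and> g w\<^sub>k\<close>, where \<open>g (e j) = col g j\<close>.\<close>

definition ext_action :: "nat \<Rightarrow> complex mat \<Rightarrow> (nat set \<Rightarrow> complex) \<Rightarrow> nat set \<Rightarrow> complex" where
  "ext_action m g a K = (\<Sum>I\<in>Pow {..<m}.
    a I * foldr ext_mult (map (\<lambda>j. ext_vec (col g j)) (sorted_list_of_set I)) ext_one K)"

text \<open>The function \<open>x\<close> stands for the sum over \<open>g\<close> of \<open>x g * g\<close>; the multiplication is
  \<open>(a * g) (b * h) = a (\<alpha> g b) * (g h)\<close>.\<close>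

definition skew_group_algebra ::
    "('r, 'a) module \<Rightarrow> ('g, 'b) monoid_scheme \<Rightarrow> ('g \<Rightarrow> 'a \<Rightarrow> 'a) \<Rightarrow> ('r, 'g \<Rightarrow> 'a) module" where
  "skew_group_algebra A G \<alpha> =
    \<lparr>carrier = carrier G \<rightarrow>\<^sub>E carrier A,
     monoid.mult = (\<lambda>x y. \<lambda>k\<in>carrier G.
       finsum A (\<lambda>(g, h). x g \<otimes>\<^bsub>A\<^esub> \<alpha> g (y h))
         {(g, h). g \<in> carrier G \<and> h \<in> carrier G \<and> g \<otimes>\<^bsub>G\<^esub> h = k}),
     one = (\<lambda>k\<in>carrier G. if k = \<one>\<^bsub>G\<^esub> then \<one>\<^bsub>A\<^esub> else \<zero>\<^bsub>A\<^esub>),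
     zero = (\<lambda>k\<in>carrier G. \<zero>\<^bsub>A\<^esub>),
     add = (\<lambda>x y. \<lambda>k\<in>carrier G. x k \<oplus>\<^bsub>A\<^esub> y k),
     smult = (\<lambda>c x. \<lambda>k\<in>carrier G. c \<odot>\<^bsub>A\<^esub> x k)\<rparr>"

definition ext_skew_algebra ::
    "nat \<Rightarrow> complex mat set \<Rightarrow> (complex, complex mat \<Rightarrow> nat set \<Rightarrow> complex) module" where
  "ext_skew_algebra m H = skew_group_algebra (ext_algebra m) (GL_sub m H) (ext_action m)"

text \<open>A representation of \<open>H\<close> as a module over the skew group algebra, elements of positive degree
  of the exterior algebra acting as zero. These are the simple modules associated to the vertices.\<close>

definition inflate :: "complex mat set \<Rightarrow> complex mat rep \<Rightarrow> (complex mat \<Rightarrow> nat set \<Rightarrow> complex) rep" where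
  "inflate H M = \<lparr>deg = deg M,
    act = (\<lambda>x. mat (deg M) (deg M) (\<lambda>(r, c). \<Sum>g\<in>H. x g {} * act M g $$ (r, c)))\<rparr>"


subsection \<open>The embedding into the special linear group\<close>

definition gl_embed :: "nat \<Rightarrow> complex mat \<Rightarrow> complex mat" where
  "gl_embed m g = four_block_mat g (0\<^sub>m m 1) (0\<^sub>m 1 m) (mat 1 1 (\<lambda>_. inverse (det g)))"

text \<open>A representation of \<open>H\<close> viewed as one of the isomorphic group \<open>f ` H\<close>.\<close>

definition transport_rep :: "('g \<Rightarrow> 'h) \<Rightarrow> 'g set \<Rightarrow> 'g rep \<Rightarrow> 'h rep" where
  "transport_rep f H M = \<lparr>deg = deg M, act = act M \<circ> inv_into H f\<rparr>"

end

theory Submission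
  imports Defs "Jordan_Normal_Form.Spectral_Radius"
begin

text \<open>Write \<open>\<chi>\<^sub>i\<close> for the character of \<open>S i\<close>. Since \<open>V = V' \<oplus> det\<^sup>-\<^sup>1\<close> as a representation of \<open>G'\<close>,
  taking traces in the decompositions of \<open>V \<otimes> S i\<close> and \<open>V' \<otimes> S i\<close> shows that the differences of the
  arrow numbers of \<open>Q\<close> and \<open>Q'\<close> are the coefficients of \<open>det\<^sup>-\<^sup>1 \<chi>\<^sub>i\<close>. So it suffices, by linear
  independence of characters, that \<open>\<chi>\<close> at \<open>\<sigma> i\<close> is \<open>det \<chi>\<^sub>i\<close>. The projective cover of \<open>S i\<close> over the
  skew group algebra is mapped to the induced module \<open>\<And>V' \<otimes> S i\<close>, and this shows that multiplication
  by the top exterior power embeds \<open>det \<otimes> S i\<close> into its socle, which is the simple module of \<open>\<sigma> i\<close>.\<close>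

section \<open>The exterior algebra\<close>

text \<open>The obstacle is that \<open>nakayama_translation\<close> supplies only some projective
  cover \<open>P\<close>, with no explicit form. Identifying \<open>P\<close> with the induced
  module would call for projectivity of the latter and uniqueness of covers. Both are avoided: the
  lifting property of \<open>P\<close> gives a map \<open>k\<close> to the induced module over the
  common quotient, and the induced module serves merely to show, after applying \<open>k\<close>,
  that the top exterior element does not annihilate what it should not. Nor is the socle of
  \<open>P\<close> computed. By \<open>socle_iso\<close> it is a copy of one simple module, so any
  simple submodule of \<open>P\<close> is that copy, and Schur's lemma turns the resulting map
  between simple modules into an isomorphism. The twist by the determinant arises because
  \<open>g\<close> passes the top element at the cost of the factor \<open>det g\<close>. Arrow
  numbers are multiplicities, hence determined by characters; comparing coefficients there replaces
  any cancellation argument for direct sums.\<close>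

lemma ext_sign_union_left:
  assumes "finite I" "finite J" "finite K" "I \<inter> J = {}"
  shows "ext_sign (I \<union> J) K = ext_sign I K * ext_sign J K"
proof -
  have "{(i, k). i \<in> I \<union> J \<and> k \<in> K \<and> k < i} =
      {(i, k). i \<in> I \<and> k \<in> K \<and> k < i} \<union> {(i, k). i \<in> J \<and> k \<in> K \<and> k < i}" by auto
  moreover have "finite {(i, k). i \<in> I \<and> k \<in> K \<and> k < i}"
    by (rule finite_subset[of _ "I \<times> K"]) (use assms in auto)
  moreover have "finite {(i, k). i \<in> J \<and> k \<in> K \<and> k < i}"
    by (rule finite_subset[of _ "J \<times> K"]) (use assms in auto)
  moreover have "{(i, k). i \<in> I \<and> k \<in> K \<and> k < i} \<inter> {(i, k). i \<in> J \<and> k \<in> K \<and> k < i} = {}"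
    using assms by auto
  ultimately show ?thesis
    by (simp add: ext_sign_def card_Un_disjoint power_add)
qed

lemma ext_sign_union_right:
  assumes "finite I" "finite J" "finite K" "J \<inter> K = {}"
  shows "ext_sign I (J \<union> K) = ext_sign I J * ext_sign I K"
proof -
  have "{(i, k). i \<in> I \<and> k \<in> J \<union> K \<and> k < i} =
      {(i, k). i \<in> I \<and> k \<in> J \<and> k < i} \<union> {(i, k). i \<in> I \<and> k \<in> K \<and> k < i}" by auto
  moreover have "finite {(i, k). i \<in> I \<and> k \<in> J \<and> k < i}"
    by (rule finite_subset[of _ "I \<times> J"]) (use assms in auto)
  moreover have "finite {(i, k). i \<in> I \<and> k \<in> K \<and> k < i}"
    by (rule finite_subset[of _ "I \<times> K"]) (use assms in auto)
  moreover have "{(i, k). i \<in> I \<and> k \<in> J \<and> k < i} \<inter> {(i, k). i \<in> I \<and> k \<in> K \<and> k < i} = {}"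
    using assms by auto
  ultimately show ?thesis
    by (simp add: ext_sign_def card_Un_disjoint power_add)
qed

lemma ext_sign_singletons:
  "ext_sign {i} {j} = (if j < i then -1 else 1)"
proof -
  have "{(a, b). a \<in> {i} \<and> b \<in> {j} \<and> b < a} = (if j < i then {(i, j)} else {})" by auto
  then show ?thesis by (simp add: ext_sign_def)
qed

lemma ext_sign_less:
  assumes "\<And>i j. i \<in> I \<Longrightarrow> j \<in> J \<Longrightarrow> i \<le> j"
  shows "ext_sign I J = 1"
proof -
  have "{(i, j). i \<in> I \<and> j \<in> J \<and> j < i} = {}" using assms by force
  then show ?thesis unfolding ext_sign_def by (simp only: card.empty power_0)
qed

text \<open>The sum over the infinite set \<open>Pow K\<close> takes the default value 0. Identities
  of products therefore hold at every set and can be stated as equations of functions.\<close>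

lemma ext_mult_infinite: "infinite K \<Longrightarrow> ext_mult a b K = 0"
  by (simp add: ext_mult_def)

text \<open>Both sides are sums over the ordered partitions of \<open>K\<close> into three parts. As
  \<open>ext_sign\<close> is multiplicative in disjoint unions, either sign is the product of the
  signs of the three pairs of parts.\<close>

lemma ext_mult_assoc: "ext_mult (ext_mult a b) c = ext_mult a (ext_mult b c)"
proof
  fix K
  show "ext_mult (ext_mult a b) c K = ext_mult a (ext_mult b c) K"
  proof (cases "finite K")
    case False
    then show ?thesis by (simp add: ext_mult_infinite)
  next
    case fin: True
    have fs: "finite L" if "L \<subseteq> K" for L using fin that by (rule rev_finite_subset)
    have "ext_mult (ext_mult a b) c K =
        (\<Sum>(L, I)\<in>Sigma (Pow K) Pow. ext_sign L (K - L) * (ext_sign I (L - I) * a I * b (L - I)) * c (K - L))"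
      using fin fs by (subst sum.Sigma[symmetric])
        (auto simp: ext_mult_def sum_distrib_left sum_distrib_right intro!: sum.cong)
    also have "\<dots> = (\<Sum>(I, J)\<in>Sigma (Pow K) (\<lambda>I. Pow (K - I)).
        ext_sign I (K - I) * a I * (ext_sign J (K - I - J) * b J * c (K - I - J)))"
    \<comment> \<open>A chain \<open>I \<subseteq> L \<subseteq> K\<close> encodes the partition
      into \<open>I\<close>, \<open>L - I\<close> and \<open>K - L\<close>.\<close>
    proof (rule sum.reindex_bij_witness[where
          i = "\<lambda>(I, J). (I \<union> J, I)" and j = "\<lambda>(L, I). (I, L - I)"])
      fix x assume "x \<in> Sigma (Pow K) Pow"
      then obtain L I where x: "x = (L, I)" and L: "L \<subseteq> K" "I \<subseteq> L" by auto
      have fL: "finite L" and fI: "finite I" using L fs by auto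
      have "ext_sign L (K - L) = ext_sign (I \<union> (L - I)) (K - L)" using L by (simp add: Un_absorb1)
      also have "\<dots> = ext_sign I (K - L) * ext_sign (L - I) (K - L)"
        using fL fI fin by (intro ext_sign_union_left) auto
      finally have 1: "ext_sign L (K - L) = ext_sign I (K - L) * ext_sign (L - I) (K - L)" .
      have "ext_sign I (K - I) = ext_sign I ((L - I) \<union> (K - L))"
        using L by (intro arg_cong[where f = "ext_sign I"]) auto
      also have "\<dots> = ext_sign I (L - I) * ext_sign I (K - L)"
        using fL fI fin by (intro ext_sign_union_right) auto
      finally have 2: "ext_sign I (K - I) = ext_sign I (L - I) * ext_sign I (K - L)" .
      have 3: "K - I - (L - I) = K - L" using L by auto
      show "(case case x of (L, I) \<Rightarrow> (I, L - I) of (I, J) \<Rightarrow> ext_sign I (K - I) * a I * (ext_sign J (K - I - J) * b J * c (K - I - J))) =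
         (case x of (L, I) \<Rightarrow> ext_sign L (K - L) * (ext_sign I (L - I) * a I * b (L - I)) * c (K - L))"
        by (simp add: x 1 2 3)
    qed auto
    also have "\<dots> = ext_mult a (ext_mult b c) K"
      using fin fs by (subst sum.Sigma[symmetric])
        (auto simp: ext_mult_def sum_distrib_left sum_distrib_right intro!: sum.cong)
    finally show ?thesis .
  qed
qed

lemma ext_mult_sum_left: "ext_mult (\<lambda>I. \<Sum>s\<in>F. a s I) b K = (\<Sum>s\<in>F. ext_mult (a s) b K)"
  unfolding ext_mult_def by (subst sum.swap) (simp add: sum_distrib_left sum_distrib_right)

lemma ext_mult_sum_right: "ext_mult a (\<lambda>I. \<Sum>s\<in>F. b s I) K = (\<Sum>s\<in>F. ext_mult a (b s) K)"
  unfolding ext_mult_def by (subst sum.swap) (simp add: sum_distrib_left)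

lemma ext_mult_scale_left: "ext_mult (\<lambda>I. c * a I) b K = c * ext_mult a b K"
  unfolding ext_mult_def by (simp add: sum_distrib_left mult_ac)

lemma ext_mult_scale_right: "ext_mult a (\<lambda>I. c * b I) K = c * ext_mult a b K"
  unfolding ext_mult_def by (simp add: sum_distrib_left mult_ac)

lemma ext_mult_uminus_left: "ext_mult (\<lambda>I. - a I) b K = - ext_mult a b K"
  using ext_mult_scale_left[of "-1"] by simp

lemma ext_mult_zero_left [simp]: "ext_mult (\<lambda>I. 0) b = (\<lambda>I. 0)"
  and ext_mult_zero_right [simp]: "ext_mult a (\<lambda>I. 0) = (\<lambda>I. 0)"
  by (auto simp: ext_mult_def)

definition ext_carrier :: "nat \<Rightarrow> (nat set \<Rightarrow> complex) set" where
  "ext_carrier m = {a. \<forall>I. a I \<noteq> 0 \<longrightarrow> I \<subseteq> {..<m}}"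

lemma ext_carrierD: "a \<in> ext_carrier m \<Longrightarrow> \<not> I \<subseteq> {..<m} \<Longrightarrow> a I = 0"
  by (auto simp: ext_carrier_def)

lemma ext_carrier_infinite: "a \<in> ext_carrier m \<Longrightarrow> infinite I \<Longrightarrow> a I = 0"
  using ext_carrierD finite_lessThan finite_subset by metis

lemma ext_mult_closed:
  assumes "a \<in> ext_carrier m" "b \<in> ext_carrier m"
  shows "ext_mult a b \<in> ext_carrier m"
  unfolding ext_carrier_def
proof (intro CollectI allI impI)
  fix K assume "ext_mult a b K \<noteq> 0"
  then obtain I where "I \<in> Pow K" "ext_sign I (K - I) * a I * b (K - I) \<noteq> 0"
    unfolding ext_mult_def by (meson sum.neutral)
  then have "I \<subseteq> {..<m}" "K - I \<subseteq> {..<m}"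
    using assms by (auto simp: ext_carrier_def)
  then show "K \<subseteq> {..<m}" by auto
qed

lemma ext_one_closed: "ext_one \<in> ext_carrier m"
  by (auto simp: ext_carrier_def ext_one_def)

lemma ext_zero_closed: "(\<lambda>I. 0) \<in> ext_carrier m"
  by (auto simp: ext_carrier_def)

lemma ext_add_closed:
  "a \<in> ext_carrier m \<Longrightarrow> b \<in> ext_carrier m \<Longrightarrow> (\<lambda>I. a I + b I) \<in> ext_carrier m"
  by (auto simp: ext_carrier_def) (metis add.right_neutral subsetD lessThan_iff add_0)

lemma ext_scale_closed: "a \<in> ext_carrier m \<Longrightarrow> (\<lambda>I. c * a I) \<in> ext_carrier m"
  by (auto simp: ext_carrier_def)

lemma ext_sum_closed:
  "(\<And>s. s \<in> F \<Longrightarrow> a s \<in> ext_carrier m) \<Longrightarrow> (\<lambda>I. \<Sum>s\<in>F. a s I) \<in> ext_carrier m"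
  unfolding ext_carrier_def
proof (intro CollectI allI impI)
  fix I assume a: "\<And>s. s \<in> F \<Longrightarrow> a s \<in> {a. \<forall>I. a I \<noteq> 0 \<longrightarrow> I \<subseteq> {..<m}}"
    and "(\<Sum>s\<in>F. a s I) \<noteq> 0"
  then obtain s where "s \<in> F" "a s I \<noteq> 0" by (meson sum.not_neutral_contains_not_neutral)
  then show "I \<subseteq> {..<m}" using a[of s] by simp
qed

text \<open>The wedge product of the standard basis vectors with index in \<open>I\<close>, in
  increasing order; \<open>wedge_col_one\<close> confirms this reading.\<close>

definition ext_basis :: "nat set \<Rightarrow> nat set \<Rightarrow> complex" where
  "ext_basis I K = (if K = I then 1 else 0)"

lemma ext_one_basis: "ext_one = ext_basis {}"
  by (auto simp: ext_one_def ext_basis_def)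

lemma ext_basis_closed: "I \<subseteq> {..<m} \<Longrightarrow> ext_basis I \<in> ext_carrier m"
  by (auto simp: ext_carrier_def ext_basis_def split: if_splits)

lemma ext_mult_basis_right:
  assumes "finite K"
  shows "ext_mult a (ext_basis J) K = (if J \<subseteq> K then ext_sign (K - J) J * a (K - J) else 0)"
proof -
  have "ext_mult a (ext_basis J) K = (\<Sum>I\<in>Pow K. if I = K - J \<and> J \<subseteq> K then ext_sign (K - J) J * a (K - J) else 0)"
    unfolding ext_mult_def by (intro sum.cong refl) (auto simp: ext_basis_def double_diff)
  then show ?thesis using assms by (cases "J \<subseteq> K") auto
qed

lemma ext_mult_one_left:
  assumes "a \<in> ext_carrier m" shows "ext_mult ext_one a = a"
proof
  fix K
  show "ext_mult ext_one a K = a K"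
  proof (cases "finite K")
    case True
    have "ext_mult ext_one a K = (\<Sum>I\<in>Pow K. if I = {} then a K else 0)"
      unfolding ext_mult_def by (intro sum.cong refl) (auto simp: ext_one_def ext_sign_def)
    then show ?thesis using True by simp
  qed (use assms in \<open>simp add: ext_mult_infinite ext_carrier_infinite\<close>)
qed

lemma ext_mult_one_right:
  assumes "a \<in> ext_carrier m" shows "ext_mult a ext_one = a"
proof
  fix K
  show "ext_mult a ext_one K = a K"
    using assms by (cases "finite K")
      (auto simp: ext_mult_infinite ext_carrier_infinite ext_one_basis ext_mult_basis_right ext_sign_def)
qed

lemma ext_vec_nonzeroD: "ext_vec v I \<noteq> 0 \<Longrightarrow> \<exists>i<dim_vec v. I = {i}"
  unfolding ext_vec_def by (erule sum.not_neutral_contains_not_neutral) (auto split: if_splits)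

lemma ext_vec_singleton: "ext_vec v {i} = (if i < dim_vec v then v $ i else 0)"
proof -
  have "ext_vec v {i} = (\<Sum>k<dim_vec v. if k = i then v $ i else 0)"
    unfolding ext_vec_def by (intro sum.cong) auto
  then show ?thesis by simp
qed

lemma ext_vec_closed: "dim_vec v \<le> m \<Longrightarrow> ext_vec v \<in> ext_carrier m"
  using ext_vec_nonzeroD by (fastforce simp: ext_carrier_def)

text \<open>Replacing \<open>I\<close> by its complement in \<open>K\<close> exchanges the two
  factors. Only pairs of distinct singletons contribute, and of their two signs exactly one is
  -1.\<close>

lemma ext_vec_anticommute:
  "ext_mult (ext_vec v) (ext_vec w) = (\<lambda>K. - ext_mult (ext_vec w) (ext_vec v) K)"
proof
  fix K
  have "ext_mult (ext_vec v) (ext_vec w) K = (\<Sum>I\<in>Pow K. ext_sign (K - I) I * ext_vec v (K - I) * ext_vec w I)"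
    unfolding ext_mult_def
    by (rule sum.reindex_bij_witness[where i = "\<lambda>I. K - I" and j = "\<lambda>I. K - I"]) (auto simp: double_diff)
  also have "\<dots> = (\<Sum>I\<in>Pow K. - (ext_sign I (K - I) * ext_vec w I * ext_vec v (K - I)))"
  proof (intro sum.cong refl)
    fix I assume I: "I \<in> Pow K"
    show "ext_sign (K - I) I * ext_vec v (K - I) * ext_vec w I = - (ext_sign I (K - I) * ext_vec w I * ext_vec v (K - I))"
    proof (cases "ext_vec v (K - I) = 0 \<or> ext_vec w I = 0")
      case False
      then obtain i j where ij: "K - I = {i}" "I = {j}" using ext_vec_nonzeroD by metis
      then have "i \<noteq> j" by auto
      then show ?thesis unfolding ij(1) unfolding ij(2) by (simp add: ext_sign_singletons)
    qed auto
  qed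
  also have "\<dots> = - ext_mult (ext_vec w) (ext_vec v) K"
    unfolding ext_mult_def by (simp add: sum_negf)
  finally show "ext_mult (ext_vec v) (ext_vec w) K = - ext_mult (ext_vec w) (ext_vec v) K" .
qed

lemma ext_vec_square: "ext_mult (ext_vec v) (ext_vec v) = (\<lambda>K. 0)"
proof
  fix K
  have "ext_mult (ext_vec v) (ext_vec v) K = - ext_mult (ext_vec v) (ext_vec v) K"
    using ext_vec_anticommute[of v v] by (rule fun_cong)
  then show "ext_mult (ext_vec v) (ext_vec v) K = 0" by simp
qed

text \<open>The products that occur in \<open>ext_action\<close>, for an arbitrary family of
  vectors: with \<open>v = col g\<close> this is the image of \<open>ext_basis I\<close> under
  \<open>g\<close>.\<close>

definition wedge :: "(nat \<Rightarrow> complex vec) \<Rightarrow> nat set \<Rightarrow> nat set \<Rightarrow> complex" where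
  "wedge v I = foldr ext_mult (map (\<lambda>j. ext_vec (v j)) (sorted_list_of_set I)) ext_one"

lemma wedge_empty [simp]: "wedge v {} = ext_one"
  by (simp add: wedge_def)

lemma wedge_insert_less:
  assumes "finite I" "\<And>i. i \<in> I \<Longrightarrow> j < i"
  shows "wedge v (insert j I) = ext_mult (ext_vec (v j)) (wedge v I)"
proof -
  have "Min (insert j I) = j" using assms by (intro Min_eqI) (auto intro: less_imp_le)
  moreover have "insert j I - {j} = I" using assms by auto
  ultimately have "sorted_list_of_set (insert j I) = j # sorted_list_of_set I"
    using sorted_list_of_set_nonempty[of "insert j I"] assms by simp
  then show ?thesis by (simp add: wedge_def)
qed

lemma wedge_singleton: "wedge v {j} = ext_vec (v j)"
  using wedge_insert_less[of "{}" j v] by (simp add: ext_mult_one_right[OF ext_vec_closed[OF order_refl]])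

text \<open>A product of vectors is homogeneous, its degree being the number of factors, because
  \<open>ext_vec\<close> is supported on singletons. This later confines the image of the top
  element to one coefficient and makes positive degrees vanish at \<open>{}\<close>.\<close>

lemma wedge_card:
  assumes "finite I" "wedge v I K \<noteq> 0"
  shows "card K = card I"
  using assms
proof (induction I arbitrary: K rule: finite_linorder_min_induct)
  case empty
  then show ?case by (simp add: ext_one_def split: if_splits)
next
  case (insert k I)
  have W: "ext_mult (ext_vec (v k)) (wedge v I) K \<noteq> 0"
    using insert.prems insert.hyps by (simp add: wedge_insert_less)
  then have "finite K" by (metis ext_mult_infinite)
  from W obtain L where "L \<in> Pow K" "ext_sign L (K - L) * ext_vec (v k) L * wedge v I (K - L) \<noteq> 0"
    unfolding ext_mult_def by (rule sum.not_neutral_contains_not_neutral)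
  then have L: "L \<subseteq> K" "ext_vec (v k) L \<noteq> 0" "wedge v I (K - L) \<noteq> 0" by auto
  obtain i where "L = {i}" using ext_vec_nonzeroD[OF L(2)] by auto
  with L \<open>finite K\<close> have "K - {i} \<subseteq> K" "i \<in> K" by auto
  moreover have "card (K - {i}) = card I" using insert.IH[OF L(3)] \<open>L = {i}\<close> by simp
  moreover have "k \<notin> I" using insert.hyps by auto
  ultimately show ?case using \<open>finite K\<close> insert.hyps by (metis card.remove card_insert_disjoint)
qed

lemma wedge_closed:
  assumes "finite I" "\<And>i. i \<in> I \<Longrightarrow> dim_vec (v i) \<le> m"
  shows "wedge v I \<in> ext_carrier m"
  using assms by (induction I rule: finite_linorder_min_induct)
    (auto simp: wedge_insert_less ext_one_closed ext_mult_closed ext_vec_closed)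

text \<open>The factor \<open>v j\<close> is moved to its place in the increasing order. Each
  smaller index that it passes costs a sign, and meeting \<open>v j\<close> itself gives 0.\<close>

lemma vec_wedge:
  assumes "finite J"
  shows "ext_mult (ext_vec (v j)) (wedge v J) =
    (if j \<in> J then (\<lambda>K. 0) else (\<lambda>K. ext_sign {j} J * wedge v (insert j J) K))"
  using assms
proof (induction J rule: finite_linorder_min_induct)
  case empty
  have "ext_sign {j} {} = 1" by (rule ext_sign_less) auto
  then show ?case by (simp add: wedge_singleton ext_mult_one_right[OF ext_vec_closed[OF order_refl]])
next
  case (insert k J)
  have W: "wedge v (insert k J) = ext_mult (ext_vec (v k)) (wedge v J)"
    using insert by (intro wedge_insert_less) auto
  consider "j < k" | "j = k" | "k < j" by linarith
  then show ?case
  proof cases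
    case 1
    have "ext_sign {j} (insert k J) = 1" using insert 1 by (intro ext_sign_less) force
    moreover have "j \<notin> insert k J" using insert 1 by force
    moreover have "wedge v (insert j (insert k J)) = ext_mult (ext_vec (v j)) (wedge v (insert k J))"
      using insert 1 by (intro wedge_insert_less) force+
    ultimately show ?thesis by simp
  next
    case 2
    then show ?thesis unfolding W ext_mult_assoc[symmetric] by (simp add: ext_vec_square)
  next
    case 3
    \<comment> \<open>Here the smallest index \<open>k\<close> has to stay in front:
      \<open>v j\<close> is exchanged with \<open>v k\<close>, and the induction hypothesis moves
      \<open>v j\<close> through the remaining product.\<close>
    have "ext_mult (ext_vec (v j)) (wedge v (insert k J)) =
        ext_mult (ext_mult (ext_vec (v j)) (ext_vec (v k))) (wedge v J)"
      by (simp add: W ext_mult_assoc)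
    also have "\<dots> = ext_mult (\<lambda>K. - ext_mult (ext_vec (v k)) (ext_vec (v j)) K) (wedge v J)"
      by (subst ext_vec_anticommute) simp
    also have "\<dots> = (\<lambda>K. - ext_mult (ext_vec (v k)) (ext_mult (ext_vec (v j)) (wedge v J)) K)"
      by (rule ext) (simp add: ext_mult_uminus_left ext_mult_assoc)
    finally have eq: "ext_mult (ext_vec (v j)) (wedge v (insert k J)) = \<dots>" .
    show ?thesis
    proof (cases "j \<in> J")
      case True
      then show ?thesis unfolding eq by (simp add: insert.IH)
    next
      case False
      have "ext_sign {j} ({k} \<union> J) = ext_sign {j} {k} * ext_sign {j} J"
        using insert by (intro ext_sign_union_right) auto
      then have "ext_sign {j} (insert k J) = - ext_sign {j} J"
        using 3 by (simp add: ext_sign_singletons)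
      moreover have "wedge v (insert k (insert j J)) = ext_mult (ext_vec (v k)) (wedge v (insert j J))"
        using insert 3 by (intro wedge_insert_less) auto
      ultimately show ?thesis unfolding eq using False 3
        by (simp add: insert.IH insert_commute ext_mult_scale_right)
    qed
  qed
qed

text \<open>Products of arbitrary vectors obey the multiplication table of the basis elements. This
  is what makes the linear extension \<open>ext_action\<close> multiplicative.\<close>

lemma wedge_mult:
  assumes "finite I" "finite J" "\<And>j. dim_vec (v j) \<le> m"
  shows "ext_mult (wedge v I) (wedge v J) =
    (if I \<inter> J = {} then (\<lambda>K. ext_sign I J * wedge v (I \<union> J) K) else (\<lambda>K. 0))"
  using assms(1)
proof (induction I rule: finite_linorder_min_induct)
  case empty
  have "ext_sign {} J = 1" by (rule ext_sign_less) auto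
  then show ?case using wedge_closed[of J v m] assms by (simp add: ext_mult_one_left)
next
  case (insert k I)
  have W: "wedge v (insert k I) = ext_mult (ext_vec (v k)) (wedge v I)"
    using insert by (intro wedge_insert_less) auto
  show ?case
  proof (cases "I \<inter> J = {}")
    case False
    then have "insert k I \<inter> J \<noteq> {}" by auto
    then show ?thesis using False insert.IH by (simp add: W ext_mult_assoc)
  next
    case True
    have eq: "ext_mult (wedge v (insert k I)) (wedge v J) =
        (\<lambda>K. ext_sign I J * ext_mult (ext_vec (v k)) (wedge v (I \<union> J)) K)"
      using True insert.IH by (auto simp: W ext_mult_assoc ext_mult_scale_right)
    show ?thesis
    proof (cases "k \<in> J")
      case True
      then show ?thesis unfolding eq using insert assms by (simp add: vec_wedge)
    next
      case False
      have "k \<notin> I" using insert by auto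
      have "ext_sign {k} (I \<union> J) = ext_sign {k} I * ext_sign {k} J"
        using insert True assms by (intro ext_sign_union_right) auto
      moreover have "ext_sign {k} I = 1" using insert by (intro ext_sign_less) force
      moreover have "ext_sign ({k} \<union> I) J = ext_sign {k} J * ext_sign I J"
        using insert \<open>k \<notin> I\<close> assms by (intro ext_sign_union_left) auto
      ultimately show ?thesis unfolding eq using insert assms False True \<open>k \<notin> I\<close>
        by (simp add: vec_wedge mult_ac)
    qed
  qed
qed

section \<open>Matrices acting on the exterior algebra by algebra homomorphisms\<close>

lemma ext_action_wedge_def:
  "ext_action m g a = (\<lambda>K. \<Sum>I\<in>Pow {..<m}. a I * wedge (col g) I K)"
  by (rule ext) (simp add: ext_action_def wedge_def)

lemma ext_action_closed:
  assumes "g \<in> carrier_mat m m"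
  shows "ext_action m g a \<in> ext_carrier m"
  unfolding ext_action_wedge_def
  using assms by (intro ext_sum_closed ext_scale_closed wedge_closed) (auto dest: rev_finite_subset[OF finite_lessThan])

lemma ext_action_sum: "ext_action m g (\<lambda>I. \<Sum>s\<in>F. a s I) K = (\<Sum>s\<in>F. ext_action m g (a s) K)"
  unfolding ext_action_wedge_def by (subst sum.swap) (simp add: sum_distrib_right)

lemma ext_action_scale: "ext_action m g (\<lambda>I. c * a I) K = c * ext_action m g a K"
  unfolding ext_action_wedge_def by (simp add: sum_distrib_left mult_ac)

lemma ext_action_basis: "I \<subseteq> {..<m} \<Longrightarrow> ext_action m g (ext_basis I) = wedge (col g) I"
  unfolding ext_action_wedge_def by (rule ext) (simp add: ext_basis_def if_distrib[of "\<lambda>x. x * _"] cong: if_cong)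

text \<open>Both sides are expanded over pairs \<open>(I, J)\<close>. Splitting the index of a
  product yields only the disjoint pairs, and on the other side the remaining pairs vanish by
  \<open>wedge_mult\<close>.\<close>

lemma ext_action_mult:
  assumes "g \<in> carrier_mat m m"
  shows "ext_action m g (ext_mult a b) = ext_mult (ext_action m g a) (ext_action m g b)"
proof
  fix N
  let ?W = "wedge (col g)" and ?M = "{..<m}"
  have fs: "finite I" if "I \<subseteq> ?M" for I using that by (rule finite_subset) simp
  have "ext_action m g (ext_mult a b) N =
      (\<Sum>(K, I)\<in>Sigma (Pow ?M) Pow. ext_sign I (K - I) * a I * b (K - I) * ?W K N)"
    unfolding ext_action_wedge_def ext_mult_def using fs
    by (subst sum.Sigma[symmetric]) (auto simp: sum_distrib_right)
  also have "\<dots> = (\<Sum>(I, J)\<in>Sigma (Pow ?M) (\<lambda>I. Pow (?M - I)). a I * b J * (ext_sign I J * ?W (I \<union> J) N))"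
    by (rule sum.reindex_bij_witness[where i = "\<lambda>(I, J). (I \<union> J, I)" and j = "\<lambda>(K, I). (I, K - I)"])
      (auto simp: Un_absorb1)
  also have "\<dots> = (\<Sum>(I, J)\<in>Pow ?M \<times> Pow ?M. a I * b J * ext_mult (?W I) (?W J) N)"
  proof (rule sum.mono_neutral_cong_left)
    show "finite (Pow ?M \<times> Pow ?M)" by simp
    show "Sigma (Pow ?M) (\<lambda>I. Pow (?M - I)) \<subseteq> Pow ?M \<times> Pow ?M" by auto
    have W: "ext_mult (?W I) (?W J) N = (if I \<inter> J = {} then ext_sign I J * ?W (I \<union> J) N else 0)"
      if "I \<subseteq> ?M" "J \<subseteq> ?M" for I J
      using wedge_mult[of I J "col g" m] that assms fs by auto
    show "\<forall>x\<in>Pow ?M \<times> Pow ?M - Sigma (Pow ?M) (\<lambda>I. Pow (?M - I)).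
        (case x of (I, J) \<Rightarrow> a I * b J * ext_mult (?W I) (?W J) N) = 0"
    proof
      fix x assume x: "x \<in> Pow ?M \<times> Pow ?M - Sigma (Pow ?M) (\<lambda>I. Pow (?M - I))"
      obtain I J where [simp]: "x = (I, J)" by (cases x)
      have "I \<subseteq> ?M" "J \<subseteq> ?M" "I \<inter> J \<noteq> {}" using x by auto
      then show "(case x of (I, J) \<Rightarrow> a I * b J * ext_mult (?W I) (?W J) N) = 0"
        using W[of I J] by simp
    qed
    show "(case x of (I, J) \<Rightarrow> a I * b J * (ext_sign I J * ?W (I \<union> J) N)) =
        (case x of (I, J) \<Rightarrow> a I * b J * ext_mult (?W I) (?W J) N)"
      if "x \<in> Sigma (Pow ?M) (\<lambda>I. Pow (?M - I))" for x
    proof -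
      obtain I J where x: "x = (I, J)" by (cases x)
      have "I \<subseteq> ?M" "J \<subseteq> ?M" "I \<inter> J = {}" using that x by auto
      then show ?thesis using W[of I J] x by simp
    qed
  qed
  also have "\<dots> = (\<Sum>I\<in>Pow ?M. \<Sum>J\<in>Pow ?M. a I * b J * ext_mult (?W I) (?W J) N)"
    by (simp add: sum.cartesian_product)
  also have "\<dots> = ext_mult (ext_action m g a) (ext_action m g b) N"
    unfolding ext_action_wedge_def
    by (simp add: ext_mult_sum_left ext_mult_sum_right ext_mult_scale_left ext_mult_scale_right
        sum_distrib_left mult_ac)
  finally show "ext_action m g (ext_mult a b) N = ext_mult (ext_action m g a) (ext_action m g b) N" .
qed

lemma ext_action_one_elt: "ext_action m g ext_one = ext_one"
  by (simp add: ext_one_basis ext_action_basis)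

lemma ext_action_vec:
  assumes g: "g \<in> carrier_mat m m" and w: "w \<in> carrier_vec m"
  shows "ext_action m g (ext_vec w) = ext_vec (g *\<^sub>v w)"
proof
  fix K
  have "ext_vec w = (\<lambda>I. \<Sum>i<m. w $ i * ext_basis {i} I)"
    using w by (intro ext) (auto simp: ext_vec_def ext_basis_def if_distrib cong: if_cong)
  then have "ext_action m g (ext_vec w) K = (\<Sum>i<m. w $ i * wedge (col g) {i} K)"
    by (simp add: ext_action_sum ext_action_scale ext_action_basis)
  also have "\<dots> = (\<Sum>i<m. w $ i * ext_vec (col g i) K)"
    by (simp add: wedge_singleton)
  also have "\<dots> = ext_vec (g *\<^sub>v w) K"
  proof (cases "\<exists>k<m. K = {k}")
    case True
    then show ?thesis using g w
      by (auto simp: ext_vec_singleton scalar_prod_def lessThan_atLeast0 mult.commute intro!: sum.cong)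
  next
    case False
    then have "ext_vec u K = 0" if "dim_vec u = m" for u using ext_vec_nonzeroD[of u K] that by auto
    then show ?thesis using g by simp
  qed
  finally show "ext_action m g (ext_vec w) K = ext_vec (g *\<^sub>v w) K" .
qed

text \<open>Multiplicativity of the action reduces the claim to single vectors, where it says that
  \<open>g\<close> maps the columns of \<open>h\<close> to the columns of
  \<open>g * h\<close>.\<close>

lemma ext_action_wedge:
  assumes g: "g \<in> carrier_mat m m" and h: "h \<in> carrier_mat m m" and I: "I \<subseteq> {..<m}"
  shows "ext_action m g (wedge (col h) I) = wedge (col (g * h)) I"
proof -
  have "finite I" using I by (rule finite_subset) simp
  then show ?thesis using I
  proof (induction I rule: finite_linorder_min_induct)
    case (insert k I)
    have "ext_action m g (wedge (col h) (insert k I)) = ext_mult (ext_vec (g *\<^sub>v col h k)) (wedge (col (g * h)) I)"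
    proof -
      have "col h k \<in> carrier_vec m" using h by auto
      then show ?thesis
        using insert g by (simp add: wedge_insert_less ext_action_mult ext_action_vec[OF g])
    qed
    also have "g *\<^sub>v col h k = col (g * h) k"
      using insert g h by (intro col_mult2[symmetric]) auto
    also have "ext_mult (ext_vec (col (g * h) k)) (wedge (col (g * h)) I) = wedge (col (g * h)) (insert k I)"
      using insert by (simp add: wedge_insert_less)
    finally show ?case .
  qed (simp add: ext_action_one_elt)
qed

lemma ext_action_comp:
  assumes "g \<in> carrier_mat m m" "h \<in> carrier_mat m m"
  shows "ext_action m g (ext_action m h a) = ext_action m (g * h) a"
proof
  fix K
  have "ext_action m g (ext_action m h a) K = (\<Sum>I\<in>Pow {..<m}. a I * ext_action m g (wedge (col h) I) K)"
    by (subst ext_action_wedge_def[of m h]) (simp add: ext_action_sum ext_action_scale)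
  also have "\<dots> = ext_action m (g * h) a K"
    unfolding ext_action_wedge_def[of m "g * h"] using assms
    by (intro sum.cong refl) (auto simp: ext_action_wedge)
  finally show "ext_action m g (ext_action m h a) K = ext_action m (g * h) a K" .
qed

lemma ext_vec_mult_basis:
  assumes "finite I" "\<And>i. i \<in> I \<Longrightarrow> k < i" "k < m"
  shows "ext_mult (ext_vec (unit_vec m k)) (ext_basis I) = ext_basis (insert k I)"
proof
  fix K
  show "ext_mult (ext_vec (unit_vec m k)) (ext_basis I) K = ext_basis (insert k I) K"
  proof (cases "finite K")
    case True
    have s: "ext_sign {k} I = 1" using assms by (intro ext_sign_less) force
    have e: "ext_vec (unit_vec m k) L = (if L = {k} then 1 else 0)" for L
    proof (cases "\<exists>i<m. L = {i}")
      case False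
      then show ?thesis using ext_vec_nonzeroD[of "unit_vec m k" L] assms by auto
    qed (use assms in \<open>auto simp: ext_vec_singleton split: if_splits\<close>)
    have "k \<notin> I" using assms by auto
    then have iff: "I \<subseteq> K \<and> K - I = {k} \<longleftrightarrow> K = insert k I" by blast
    have "ext_mult (ext_vec (unit_vec m k)) (ext_basis I) K =
        (if I \<subseteq> K \<and> K - I = {k} then ext_sign {k} I else 0)"
      unfolding ext_mult_basis_right[OF True] e by simp
    then show ?thesis unfolding iff s by (simp add: ext_basis_def)
  next
    case False
    then show ?thesis using assms by (auto simp: ext_mult_infinite ext_basis_def)
  qed
qed

lemma wedge_col_one:
  assumes "I \<subseteq> {..<m}"
  shows "wedge (col (1\<^sub>m m)) I = ext_basis I"
proof -
  have "finite I" using assms by (rule finite_subset) simp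
  then show ?thesis using assms
  proof (induction I rule: finite_linorder_min_induct)
    case (insert k I)
    then show ?case by (simp add: wedge_insert_less ext_vec_mult_basis)
  qed (simp add: ext_one_basis)
qed

lemma ext_action_id:
  assumes "a \<in> ext_carrier m"
  shows "ext_action m (1\<^sub>m m) a = a"
proof
  fix K
  have "ext_action m (1\<^sub>m m) a K = (\<Sum>I\<in>Pow {..<m}. if I = K then a K else 0)"
    unfolding ext_action_wedge_def
    by (intro sum.cong) (auto simp: wedge_col_one ext_basis_def)
  then show "ext_action m (1\<^sub>m m) a K = a K" using ext_carrierD[OF assms, of K] by auto
qed

lemma ext_action_degree_zero:
  assumes "g \<in> carrier_mat m m"
  shows "ext_action m g a {} = a {}"
proof -
  have "wedge (col g) I {} = 0" if "finite I" "I \<noteq> {}" for I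
    using wedge_card[OF that(1), of "col g" "{}"] that by auto
  then have "ext_action m g a {} = (\<Sum>I\<in>Pow {..<m}. if I = {} then a {} else 0)"
    unfolding ext_action_wedge_def by (intro sum.cong) (auto simp: ext_one_def dest: rev_finite_subset[OF finite_lessThan])
  then show ?thesis by simp
qed

text \<open>Laplace expansion along the first column: the sign in \<open>ext_mult (ext_vec u) _\<close> at the index
  \<open>\<kappa> i\<close> is \<open>(-1) ^ i\<close>, because \<open>\<kappa>\<close> is increasing.\<close>

lemma wedge_eq_det:
  assumes "\<And>j. dim_vec (v j) = m" "strict_mono_on {..<k} \<kappa>" "\<And>i. i < k \<Longrightarrow> \<kappa> i < m"
  shows "wedge v {s..<s + k} (\<kappa> ` {..<k}) = det (mat k k (\<lambda>(i, j). v (s + j) $ \<kappa> i))"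
  using assms(2,3)
\<comment> \<open>The first column \<open>s\<close> and the selection \<open>\<kappa>\<close> of
  rows must vary, since a cofactor is the determinant of the later columns on a smaller set of
  rows.\<close>
proof (induction k arbitrary: s \<kappa>)
  case 0
  then show ?case by (simp add: ext_one_def det_def)
next
  case (Suc k)
  let ?K = "\<kappa> ` {..<Suc k}" and ?A = "mat (Suc k) (Suc k) (\<lambda>(i, j). v (s + j) $ \<kappa> i)"
  let ?W = "wedge v {Suc s..<Suc s + k}"
  have inj: "inj_on \<kappa> {..<Suc k}" using Suc.prems(1) by (rule strict_mono_on_imp_inj_on)
  have "{s..<s + Suc k} = insert s {Suc s..<Suc s + k}" by auto
  then have "wedge v {s..<s + Suc k} ?K = ext_mult (ext_vec (v s)) ?W ?K"
    using wedge_insert_less[of "{Suc s..<Suc s + k}" s v] by auto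
  also have "\<dots> = (\<Sum>I\<in>(\<lambda>i. {\<kappa> i}) ` {..<Suc k}. ext_sign I (?K - I) * ext_vec (v s) I * ?W (?K - I))"
    unfolding ext_mult_def
  proof (rule sum.mono_neutral_right)
    show "\<forall>I\<in>Pow ?K - (\<lambda>i. {\<kappa> i}) ` {..<Suc k}. ext_sign I (?K - I) * ext_vec (v s) I * ?W (?K - I) = 0"
      using ext_vec_nonzeroD[of "v s"] by fastforce
  qed auto
  also have "\<dots> = (\<Sum>i<Suc k. ext_sign {\<kappa> i} (?K - {\<kappa> i}) * ext_vec (v s) {\<kappa> i} * ?W (?K - {\<kappa> i}))"
    using inj by (subst sum.reindex) (auto simp: inj_on_def)
  also have "\<dots> = (\<Sum>i<Suc k. ?A $$ (i, 0) * cofactor ?A i 0)"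
  proof (intro sum.cong refl)
    fix i assume i: "i \<in> {..<Suc k}"
    have less: "\<kappa> a < \<kappa> b \<longleftrightarrow> a < b" if "a < Suc k" "b < Suc k" for a b
      using Suc.prems(1) that by (simp add: strict_mono_on_less)
    have "{(a, b). a \<in> {\<kappa> i} \<and> b \<in> ?K - {\<kappa> i} \<and> b < a} = (\<lambda>j. (\<kappa> i, \<kappa> j)) ` {..<i}"
      using i less inj by (auto simp: image_iff inj_on_def)
    moreover have "inj_on (\<lambda>j. (\<kappa> i, \<kappa> j)) {..<i}"
      using inj i by (auto simp: inj_on_def)
    ultimately have sign: "ext_sign {\<kappa> i} (?K - {\<kappa> i}) = (-1) ^ i"
      by (simp add: ext_sign_def card_image)
    \<comment> \<open>\<open>\<kappa>'\<close> enumerates in increasing order the rows that remain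
      when the one with number \<open>i\<close> is deleted.\<close>
    define \<kappa>' where "\<kappa>' = \<kappa> \<circ> insert_index i"
    have ins: "insert_index i ` {..<k} = {..<Suc k} - {i}"
    proof -
      have "x \<in> insert_index i ` {..<k}" if "x < Suc k" "x \<noteq> i" for x
        using i that by (intro image_eqI[where x = "if x < i then x else x - 1"]) (auto simp: insert_index_def)
      then show ?thesis by (auto simp: insert_index_def split: if_splits)
    qed
    have img: "\<kappa>' ` {..<k} = ?K - {\<kappa> i}"
      unfolding \<kappa>'_def image_comp[symmetric] ins
      using inj i by (auto simp: inj_on_def image_iff)
    have "strict_mono_on {..<k} \<kappa>'"
      unfolding \<kappa>'_def using less
      by (auto simp: strict_mono_on_def insert_index_def)
    moreover have "\<kappa>' j < m" if "j < k" for j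
      using that Suc.prems(2) by (auto simp: \<kappa>'_def insert_index_def)
    ultimately have "?W (?K - {\<kappa> i}) = det (mat k k (\<lambda>(i, j). v (Suc s + j) $ \<kappa>' i))"
      using Suc.IH[of \<kappa>' "Suc s"] img by simp
    also have "mat k k (\<lambda>(i, j). v (Suc s + j) $ \<kappa>' i) = mat_delete ?A i 0"
      by (rule eq_matI) (auto simp: mat_delete_def \<kappa>'_def insert_index_def)
    finally show "ext_sign {\<kappa> i} (?K - {\<kappa> i}) * ext_vec (v s) {\<kappa> i} * ?W (?K - {\<kappa> i}) =
        ?A $$ (i, 0) * cofactor ?A i 0"
      using i Suc.prems(2) by (simp add: sign cofactor_def ext_vec_singleton assms(1))
  qed
  also have "\<dots> = det ?A"
    by (rule laplace_expansion_column[symmetric]) auto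
  finally show ?case .
qed

text \<open>The image is homogeneous of degree \<open>m\<close> and supported on subsets of
  \<open>{..<m}\<close>, so \<open>{..<m}\<close> is the only possible index. Its coefficient is the
  case of \<open>wedge_eq_det\<close> in which all rows are selected.\<close>

lemma ext_action_top:
  assumes g: "g \<in> carrier_mat m m"
  shows "ext_action m g (ext_basis {..<m}) = (\<lambda>K. det g * ext_basis {..<m} K)"
proof
  fix K
  let ?W = "wedge (col g) {..<m}"
  have W: "ext_action m g (ext_basis {..<m}) = ?W" by (simp add: ext_action_basis)
  have top: "?W {..<m} = det g"
  proof -
    have "wedge (col g) {0..<0 + m} (id ` {..<m}) = det (mat m m (\<lambda>(i, j). col g (0 + j) $ id i))"
      using g by (intro wedge_eq_det[where m = m]) (auto simp: strict_mono_on_def)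
    also have "mat m m (\<lambda>(i, j). col g (0 + j) $ id i) = g" using g by auto
    finally show ?thesis by (simp add: lessThan_atLeast0)
  qed
  show "ext_action m g (ext_basis {..<m}) K = det g * ext_basis {..<m} K"
  proof (cases "K = {..<m}")
    case True
    then show ?thesis using top W by (simp add: ext_basis_def)
  next
    case neq: False
    have "?W K = 0"
    proof (rule ccontr)
      assume "?W K \<noteq> 0"
      moreover have "?W \<in> ext_carrier m" using g by (intro wedge_closed) auto
      ultimately have "K \<subseteq> {..<m}" "card K = card {..<m}"
        using wedge_card[of "{..<m}" "col g" K] by (auto simp: ext_carrier_def)
      then show False using neq card_subset_eq by blast
    qed
    then show ?thesis using neq W by (simp add: ext_basis_def)
  qed
qed

section \<open>The skew group algebra and its induced modules\<close>

lemma ext_algebra_simps [simp]: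
  "carrier (ext_algebra m) = ext_carrier m" "monoid.mult (ext_algebra m) = ext_mult"
  "one (ext_algebra m) = ext_one" "zero (ext_algebra m) = (\<lambda>_. 0)"
  "add (ext_algebra m) = (\<lambda>a b I. a I + b I)" "module.smult (ext_algebra m) = (\<lambda>c a I. c * a I)"
  by (simp_all add: ext_algebra_def ext_carrier_def)

lemma ext_algebra_abelian_monoid: "abelian_monoid (ext_algebra m)"
  by (rule abelian_monoidI) (auto simp: ext_add_closed ext_zero_closed add_ac)

text \<open>Turns the abstract sum in the multiplication of the skew group algebra into pointwise
  sums of complex numbers, which can be reindexed and interchanged.\<close>

lemma ext_algebra_finsum:
  assumes "\<And>s. s \<in> F \<Longrightarrow> f s \<in> ext_carrier m"
  shows "finsum (ext_algebra m) f F = (\<lambda>I. \<Sum>s\<in>F. f s I)"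
  using assms
proof (induction F rule: infinite_finite_induct)
  interpret abelian_monoid "ext_algebra m" by (rule ext_algebra_abelian_monoid)
  {
    case (infinite F)
    then show ?case by (simp add: finsum_infinite)
  next
    case empty
    then show ?case by simp
  next
    case (insert s F)
    then show ?case by (subst finsum_insert) auto
  }
qed

lemma ext_mult_add_left: "ext_mult (\<lambda>I. a I + b I) c K = ext_mult a c K + ext_mult b c K"
  by (simp add: ext_mult_def algebra_simps sum.distrib)

lemma GL_simps [simp]: "monoid.mult (GL n) = (*)" "one (GL n) = 1\<^sub>m n"
  by (simp_all add: GL_def units_of_def ring_mat_simps)

lemma GL_group: "group (GL n)"
  unfolding GL_def by (intro monoid.units_group ring.is_monoid ring_mat)

lemma GL_carrier_mat: "g \<in> carrier (GL n) \<Longrightarrow> g \<in> carrier_mat n n"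
  by (simp add: GL_def units_of_def Units_def ring_mat_simps)

section \<open>Finite matrix groups and their skew group algebras\<close>

locale finite_matrix_group =
  fixes m :: nat and H :: "complex mat set"
  assumes finite: "finite H" and subgroup: "subgroup H (GL m)"
begin

lemma mat [simp]: "g \<in> H \<Longrightarrow> g \<in> carrier_mat m m"
  using subgroup.subset[OF subgroup] GL_carrier_mat by auto

lemma one [simp]: "1\<^sub>m m \<in> H"
  using subgroup.one_closed[OF subgroup] by simp

lemma mult [simp]: "g \<in> H \<Longrightarrow> h \<in> H \<Longrightarrow> g * h \<in> H"
  using subgroup.m_closed[OF subgroup] by simp

lemma group: "group (GL_sub m H)"
  using subgroup.subgroup_is_group[OF subgroup GL_group] .

definition "ginv = m_inv (GL m)"

lemma ginv [simp]:
  assumes "g \<in> H"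
  shows "ginv g \<in> H" "ginv g * g = 1\<^sub>m m" "g * ginv g = 1\<^sub>m m"
  using subgroup.m_inv_closed[OF subgroup assms] group.l_inv[OF GL_group] group.r_inv[OF GL_group]
    subgroup.mem_carrier[OF subgroup assms] by (auto simp: ginv_def)

lemma translate: "g \<in> H \<Longrightarrow> bij_betw (\<lambda>h. g * h) H H"
  by (rule bij_betw_byWitness[where f' = "\<lambda>h. ginv g * h"])
    (auto simp: assoc_mult_mat[symmetric, of _ m m _ m _ m] left_mult_one_mat[OF mat])

lemma rep_mat:
  assumes "group_rep (GL_sub m H) M" "g \<in> H" shows "act M g \<in> carrier_mat (deg M) (deg M)"
  using assms GL_carrier_mat by (auto simp: group_rep_def hom_def)

lemma rep_mult:
  assumes "group_rep (GL_sub m H) M" "g \<in> H" "h \<in> H" shows "act M (g * h) = act M g * act M h"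
  using assms by (auto simp: group_rep_def hom_def)

lemma rep_one:
  assumes "group_rep (GL_sub m H) M" shows "act M (1\<^sub>m m) = 1\<^sub>m (deg M)"
proof -
  interpret group_hom "GL_sub m H" "GL (deg M)" "act M"
    using assms group GL_group by (auto simp: group_hom_def group_hom_axioms_def group_rep_def)
  show ?thesis using hom_one by simp
qed

lemma rep_ginv:
  assumes "group_rep (GL_sub m H) M" "g \<in> H"
  shows "act M g * act M (ginv g) = 1\<^sub>m (deg M)" "act M (ginv g) * act M g = 1\<^sub>m (deg M)"
  using rep_mult[OF assms(1), of g "ginv g"] rep_mult[OF assms(1), of "ginv g" g] assms
  by (simp_all add: rep_one)

abbreviation "A \<equiv> ext_skew_algebra m H"

lemma skew_carrier: "carrier A = H \<rightarrow>\<^sub>E ext_carrier m"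
  by (simp add: ext_skew_algebra_def skew_group_algebra_def)

lemma skew_carrierD: "x \<in> carrier A \<Longrightarrow> g \<in> H \<Longrightarrow> x g \<in> ext_carrier m"
  by (auto simp: skew_carrier)

lemma skew_add: "x \<oplus>\<^bsub>A\<^esub> y = (\<lambda>k\<in>H. \<lambda>I. x k I + y k I)"
  by (simp add: ext_skew_algebra_def skew_group_algebra_def)

lemma skew_smult: "c \<odot>\<^bsub>A\<^esub> x = (\<lambda>k\<in>H. \<lambda>I. c * x k I)"
  by (simp add: ext_skew_algebra_def skew_group_algebra_def)

lemma skew_one: "\<one>\<^bsub>A\<^esub> = (\<lambda>k\<in>H. if k = 1\<^sub>m m then ext_one else (\<lambda>_. 0))"
  by (simp add: ext_skew_algebra_def skew_group_algebra_def cong: if_cong)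

lemma skew_mult:
  assumes "x \<in> carrier A" "y \<in> carrier A"
  shows "x \<otimes>\<^bsub>A\<^esub> y = (\<lambda>k\<in>H. \<lambda>I. \<Sum>(g, h)\<in>{p \<in> H \<times> H. fst p * snd p = k}.
    ext_mult (x g) (ext_action m g (y h)) I)"
proof -
  have "finsum (ext_algebra m) (\<lambda>(g, h). ext_mult (x g) (ext_action m g (y h))) {(g, h). g \<in> H \<and> h \<in> H \<and> g * h = k}
     = (\<lambda>I. \<Sum>p\<in>{(g, h). g \<in> H \<and> h \<in> H \<and> g * h = k}. (case p of (g, h) \<Rightarrow> ext_mult (x g) (ext_action m g (y h))) I)" for k
    using assms by (intro ext_algebra_finsum) (auto intro!: ext_mult_closed ext_action_closed dest: skew_carrierD)
  moreover have "{(g, h). g \<in> H \<and> h \<in> H \<and> g * h = k} = {p \<in> H \<times> H. fst p * snd p = k}" for k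
    by auto
  ultimately show ?thesis
    by (auto simp: ext_skew_algebra_def skew_group_algebra_def fun_eq_iff split_def)
qed

end

text \<open>Rows and columns carry labels, enumerated by \<open>e\<close> and \<open>f\<close>. Maps
  between spaces with labelled bases can thus be given by kernels on the labels, and multiplied
  without arithmetic on matrix positions.\<close>

definition index_mat :: "nat \<Rightarrow> nat \<Rightarrow> (nat \<Rightarrow> 'i) \<Rightarrow> (nat \<Rightarrow> 'j) \<Rightarrow> ('i \<Rightarrow> 'j \<Rightarrow> complex) \<Rightarrow> complex mat" where
  "index_mat a b e f K = mat a b (\<lambda>(p, q). K (e p) (f q))"

lemma index_mat_carrier [simp]: "index_mat a b e f K \<in> carrier_mat a b"
  by (simp add: index_mat_def)

lemma index_mat_mult:
  assumes "bij_betw f {..<b} B"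
  shows "index_mat a b e f K * index_mat b c f g L = index_mat a c e g (\<lambda>i k. \<Sum>j\<in>B. K i j * L j k)"
  by (rule eq_matI) (auto simp: index_mat_def scalar_prod_def lessThan_atLeast0[symmetric]
      sum.reindex_bij_betw[OF assms, symmetric])

lemma index_mat_cong:
  assumes "bij_betw e {..<a} B" "bij_betw f {..<b} C"
    and "\<And>i j. i \<in> B \<Longrightarrow> j \<in> C \<Longrightarrow> K i j = L i j"
  shows "index_mat a b e f K = index_mat a b e f L"
  using assms by (intro eq_matI) (auto simp: index_mat_def bij_betw_def)

lemma index_mat_one:
  assumes "bij_betw e {..<a} B"
  shows "index_mat a a e e (\<lambda>i j. if i = j then 1 else 0) = 1\<^sub>m a"
  using assms by (intro eq_matI) (auto simp: index_mat_def bij_betw_def inj_on_def)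

text \<open>Which enumeration of the basis is taken does not matter, but it is fixed once so that
  all maps into and out of the induced module refer to the same one.\<close>

definition free_index :: "nat \<Rightarrow> nat \<Rightarrow> nat \<Rightarrow> nat set \<times> nat" where
  "free_index m d = (SOME e. bij_betw e {..<2 ^ m * d} (Pow {..<m} \<times> {..<d}))"

lemma free_index: "bij_betw (free_index m d) {..<2 ^ m * d} (Pow {..<m} \<times> {..<d})"
proof -
  have "\<exists>e. bij_betw e {..<2 ^ m * d} (Pow {..<m} \<times> {..<d})"
    using ex_bij_betw_nat_finite[of "Pow {..<m} \<times> {..<d}"]
    by (simp add: card_cartesian_product card_Pow lessThan_atLeast0)
  then show ?thesis unfolding free_index_def by (rule someI_ex)
qed

text \<open>The module \<open>\<And>W \<otimes> M\<close> induced from a representation \<open>M\<close> of \<open>H\<close>, on the basis of the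
  \<open>e\<^sub>J \<otimes> u\<^sub>c\<close>; the element \<open>a * g\<close> maps \<open>e\<^sub>J \<otimes> u\<^sub>c\<close> to \<open>(a \<and> g e\<^sub>J) \<otimes> g u\<^sub>c\<close>.\<close>

definition induced_kernel :: "nat \<Rightarrow> complex mat set \<Rightarrow> complex mat rep \<Rightarrow> (complex mat \<Rightarrow> nat set \<Rightarrow> complex) \<Rightarrow>
    nat set \<times> nat \<Rightarrow> nat set \<times> nat \<Rightarrow> complex" where
  "induced_kernel m H M x = (\<lambda>(I, r) (J, c).
     \<Sum>g\<in>H. ext_mult (x g) (ext_action m g (ext_basis J)) I * act M g $$ (r, c))"

definition induced_module :: "nat \<Rightarrow> complex mat set \<Rightarrow> complex mat rep \<Rightarrow> (complex mat \<Rightarrow> nat set \<Rightarrow> complex) rep" where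
  "induced_module m H M = \<lparr>deg = 2 ^ m * deg M,
    act = (\<lambda>x. index_mat (2 ^ m * deg M) (2 ^ m * deg M) (free_index m (deg M)) (free_index m (deg M))
      (induced_kernel m H M x))\<rparr>"

text \<open>The map that sends \<open>b\<close> to \<open>a\<close> times \<open>g b\<close> is
  recovered from its values on the basis. In a product of two kernels this contracts the exterior
  part of the middle index.\<close>

lemma ext_mult_action_expand:
  "(\<Sum>J\<in>Pow {..<m}. ext_mult a (ext_action m g (ext_basis J)) I * b J) = ext_mult a (ext_action m g b) I"
proof -
  have "ext_action m g b = (\<lambda>K. \<Sum>J\<in>Pow {..<m}. b J * ext_action m g (ext_basis J) K)"
    by (subst ext_action_wedge_def) (auto simp: ext_action_basis)
  then show ?thesis
    by (simp add: ext_mult_sum_right ext_mult_scale_right mult.commute)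
qed

context finite_matrix_group
begin

text \<open>For fixed \<open>g\<close> and \<open>h\<close> the sum over the middle index factors.
  The group part gives \<open>act M (g * h)\<close>; in the exterior part the action of
  \<open>g\<close> distributes over the product, and associativity then produces the coefficient of
  the skew product. Collecting the pairs \<open>(g, h)\<close> with equal product finishes the
  computation.\<close>

lemma induced_kernel_mult:
  assumes M: "group_rep (GL_sub m H) M" and x: "x \<in> carrier A" and y: "y \<in> carrier A"
    and "r < deg M" "t < deg M"
  shows "(\<Sum>j\<in>Pow {..<m} \<times> {..<deg M}. induced_kernel m H M x (I, r) j * induced_kernel m H M y j (K, t))
    = induced_kernel m H M (x \<otimes>\<^bsub>A\<^esub> y) (I, r) (K, t)"
proof -
  let ?e = ext_basis and ?d = "deg M"
  let ?X = "\<lambda>g J. ext_mult (x g) (ext_action m g (?e J)) I"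
  let ?Y = "\<lambda>h. ext_mult (y h) (ext_action m h (?e K))"
  let ?T = "\<lambda>g h. ext_mult (ext_mult (x g) (ext_action m g (y h))) (ext_action m (g * h) (?e K)) I * act M (g * h) $$ (r, t)"
  have "(\<Sum>j\<in>Pow {..<m} \<times> {..<?d}. induced_kernel m H M x (I, r) j * induced_kernel m H M y j (K, t)) =
      (\<Sum>J\<in>Pow {..<m}. \<Sum>c<?d. \<Sum>g\<in>H. \<Sum>h\<in>H. (?X g J * act M g $$ (r, c)) * (?Y h J * act M h $$ (c, t)))"
    unfolding sum.cartesian_product' by (simp add: induced_kernel_def sum_product)
  also have "\<dots> = (\<Sum>g\<in>H. \<Sum>h\<in>H. \<Sum>J\<in>Pow {..<m}. \<Sum>c<?d. (?X g J * act M g $$ (r, c)) * (?Y h J * act M h $$ (c, t)))"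
    by (simp only: sum.swap[of _ H "{..<?d}"] sum.swap[of _ H "Pow {..<m}"])
  also have "\<dots> = (\<Sum>g\<in>H. \<Sum>h\<in>H. ?T g h)"
  proof (intro sum.cong refl)
    fix g h assume g: "g \<in> H" and h: "h \<in> H"
    have "(\<Sum>J\<in>Pow {..<m}. \<Sum>c<?d. (?X g J * act M g $$ (r, c)) * (?Y h J * act M h $$ (c, t))) =
        (\<Sum>J\<in>Pow {..<m}. ?X g J * ?Y h J) * (\<Sum>c<?d. act M g $$ (r, c) * act M h $$ (c, t))"
      unfolding sum_product by (simp add: mult_ac)
    also have "(\<Sum>c<?d. act M g $$ (r, c) * act M h $$ (c, t)) = act M (g * h) $$ (r, t)"
      using assms rep_mat[OF M g] rep_mat[OF M h]
      by (simp add: rep_mult[OF M g h] scalar_prod_def lessThan_atLeast0)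
    also have "(\<Sum>J\<in>Pow {..<m}. ?X g J * ?Y h J) = ext_mult (x g) (ext_action m g (?Y h)) I"
      by (rule ext_mult_action_expand)
    also have "\<dots> = ext_mult (ext_mult (x g) (ext_action m g (y h))) (ext_action m (g * h) (?e K)) I"
      using g h by (simp add: ext_action_mult ext_action_comp ext_mult_assoc)
    finally show "(\<Sum>J\<in>Pow {..<m}. \<Sum>c<?d. (?X g J * act M g $$ (r, c)) * (?Y h J * act M h $$ (c, t))) = ?T g h" .
  qed
  also have "\<dots> = (\<Sum>p\<in>H \<times> H. ?T (fst p) (snd p))"
    by (simp add: sum.cartesian_product split_def)
  also have "\<dots> = (\<Sum>k\<in>H. \<Sum>p\<in>{p \<in> H \<times> H. fst p * snd p = k}. ?T (fst p) (snd p))"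
    by (rule sum.group[symmetric]) (use finite in auto)
  also have "\<dots> = induced_kernel m H M (x \<otimes>\<^bsub>A\<^esub> y) (I, r) (K, t)"
    by (auto simp: induced_kernel_def skew_mult[OF x y] ext_mult_sum_left sum_distrib_right split_def intro!: sum.cong)
  finally show ?thesis .
qed

lemma induced_module:
  assumes M: "group_rep (GL_sub m H) M"
  shows "alg_module A (induced_module m H M)"
proof -
  let ?B = "Pow {..<m} \<times> {..<deg M}" and ?e = "free_index m (deg M)" and ?N = "2 ^ m * deg M"
  note bij = free_index[of m "deg M"]
  have add: "induced_kernel m H M (x \<oplus>\<^bsub>A\<^esub> y) i j = induced_kernel m H M x i j + induced_kernel m H M y i j" for x y i j
    by (cases i; cases j) (simp add: induced_kernel_def skew_add ext_mult_add_left algebra_simps sum.distrib)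
  have smult: "induced_kernel m H M (c \<odot>\<^bsub>A\<^esub> x) i j = c * induced_kernel m H M x i j" for c x i j
    by (cases i; cases j) (simp add: induced_kernel_def skew_smult ext_mult_scale_left sum_distrib_left mult_ac)
  have one: "induced_kernel m H M \<one>\<^bsub>A\<^esub> i j = (if i = j then 1 else 0)" if ij: "i \<in> ?B" "j \<in> ?B" for i j
  proof -
    obtain I r J c where [simp]: "i = (I, r)" "j = (J, c)" by (cases i; cases j)
    have "induced_kernel m H M \<one>\<^bsub>A\<^esub> i j =
        (\<Sum>g\<in>H. if g = 1\<^sub>m m then ext_mult ext_one (ext_action m g (ext_basis J)) I * act M g $$ (r, c) else 0)"
      by (auto simp: induced_kernel_def skew_one intro!: sum.cong)
    also have "\<dots> = ext_mult ext_one (ext_action m (1\<^sub>m m) (ext_basis J)) I * act M (1\<^sub>m m) $$ (r, c)"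
      using finite by simp
    also have "\<dots> = (if i = j then 1 else 0)"
      using ij ext_basis_closed[of J m]
      by (auto simp: ext_action_id ext_mult_one_left rep_one[OF M] ext_basis_def)
    finally show ?thesis .
  qed
  have "act (induced_module m H M) (x \<otimes>\<^bsub>A\<^esub> y) = act (induced_module m H M) x * act (induced_module m H M) y"
    if "x \<in> carrier A" "y \<in> carrier A" for x y
    unfolding induced_module_def using induced_kernel_mult[OF M that]
    by (auto simp: index_mat_mult[OF bij] intro!: index_mat_cong[OF bij bij])
  moreover have "act (induced_module m H M) (x \<oplus>\<^bsub>A\<^esub> y) = act (induced_module m H M) x + act (induced_module m H M) y" for x y
    by (rule eq_matI) (auto simp: induced_module_def index_mat_def add)
  moreover have "act (induced_module m H M) (c \<odot>\<^bsub>A\<^esub> x) = c \<cdot>\<^sub>m act (induced_module m H M) x" for c x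
    by (rule eq_matI) (auto simp: induced_module_def index_mat_def smult)
  moreover have "act (induced_module m H M) \<one>\<^bsub>A\<^esub> = 1\<^sub>m (deg (induced_module m H M))"
    using index_mat_cong[OF bij bij one] index_mat_one[OF bij] by (simp add: induced_module_def)
  moreover have "act (induced_module m H M) x \<in> carrier_mat (deg (induced_module m H M)) (deg (induced_module m H M))" for x
    by (simp add: induced_module_def)
  ultimately show ?thesis
    by (simp add: alg_module_def Ring.ring_hom_def ring_mat_simps)
qed

end

section \<open>Schur's lemma and characters\<close>

lemma subspace_iff:
  "VectorSpace.subspace class_ring U (module_vec TYPE(complex) n) \<longleftrightarrow>
    U \<subseteq> carrier_vec n \<and> 0\<^sub>v n \<in> U \<and> (\<forall>u\<in>U. \<forall>v\<in>U. u + v \<in> U) \<and> (\<forall>c. \<forall>u\<in>U. c \<cdot>\<^sub>v u \<in> U)"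
  using vec_vs[of n, where 'a = complex] vec_module[of n, where 'a = complex]
  by (auto simp: VectorSpace.subspace_def submodule_def module_vec_simps)

text \<open>Only the sizes of the matrices are recorded, so that one version of Schur's lemma serves
  group representations and algebra modules alike.\<close>

definition rep_on :: "'x set \<Rightarrow> 'x rep \<Rightarrow> bool" where
  "rep_on X M \<longleftrightarrow> (\<forall>x\<in>X. act M x \<in> carrier_mat (deg M) (deg M))"

lemma intertwinersD:
  assumes "T \<in> intertwiners X M N"
  shows "T \<in> carrier_mat (deg N) (deg M)" "x \<in> X \<Longrightarrow> T * act M x = act N x * T"
  using assms by (auto simp: intertwiners_def)

lemma intertwiner_vec:
  assumes T: "T \<in> intertwiners X M N" and "rep_on X M" "rep_on X N" "x \<in> X" "v \<in> carrier_vec (deg M)"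
  shows "T *\<^sub>v (act M x *\<^sub>v v) = act N x *\<^sub>v (T *\<^sub>v v)"
proof -
  have "act M x \<in> carrier_mat (deg M) (deg M)" "act N x \<in> carrier_mat (deg N) (deg N)"
    using assms by (auto simp: rep_on_def)
  then show ?thesis
    using intertwinersD[OF T] assms by (metis assoc_mult_mat_vec)
qed

lemma subrep_preimage:
  assumes T: "T \<in> intertwiners X M N" and M: "rep_on X M" and N: "rep_on X N" and U: "subrep X N U"
  shows "subrep X M {v \<in> carrier_vec (deg M). T *\<^sub>v v \<in> U}"
proof -
  note c = intertwinersD(1)[OF T]
  have z: "T *\<^sub>v 0\<^sub>v (deg M) = 0\<^sub>v (deg N)" using c by auto
  show ?thesis
    using U M unfolding subrep_def subspace_iff
    by (auto simp: mult_add_distrib_mat_vec[OF c] mult_mat_vec[OF c] z intertwiner_vec[OF T M N] rep_on_def)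
qed

lemma subrep_image:
  assumes T: "T \<in> intertwiners X M N" and M: "rep_on X M" and N: "rep_on X N" and U: "subrep X M U"
  shows "subrep X N ((*\<^sub>v) T ` U)"
proof -
  note c = intertwinersD(1)[OF T]
  have sub: "U \<subseteq> carrier_vec (deg M)" and u0: "0\<^sub>v (deg M) \<in> U"
    and add: "\<And>u v. u \<in> U \<Longrightarrow> v \<in> U \<Longrightarrow> u + v \<in> U" and smult: "\<And>a u. u \<in> U \<Longrightarrow> a \<cdot>\<^sub>v u \<in> U"
    and inv: "\<And>x u. x \<in> X \<Longrightarrow> u \<in> U \<Longrightarrow> act M x *\<^sub>v u \<in> U"
    using U unfolding subrep_def subspace_iff by auto
  have z: "T *\<^sub>v 0\<^sub>v (deg M) = 0\<^sub>v (deg N)" using c by auto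
  show ?thesis
    unfolding subrep_def subspace_iff
  proof (intro conjI ballI allI)
    show "(*\<^sub>v) T ` U \<subseteq> carrier_vec (deg N)" using c sub by auto
    show "0\<^sub>v (deg N) \<in> (*\<^sub>v) T ` U" using z u0 by (metis imageI)
    fix p assume "p \<in> (*\<^sub>v) T ` U"
    then obtain u where u: "u \<in> U" "p = T *\<^sub>v u" by auto
    show "a \<cdot>\<^sub>v p \<in> (*\<^sub>v) T ` U" for a
      using u smult[of u a] mult_mat_vec[OF c, of u a] sub by (metis imageI subsetD)
    show "act N x *\<^sub>v p \<in> (*\<^sub>v) T ` U" if "x \<in> X" for x
      using u inv[OF that] intertwiner_vec[OF T M N that, of u] sub by (metis imageI subsetD)
    fix q assume "q \<in> (*\<^sub>v) T ` U"
    then obtain v where v: "v \<in> U" "q = T *\<^sub>v v" by auto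
    show "p + q \<in> (*\<^sub>v) T ` U"
      using u v add[of u v] mult_add_distrib_mat_vec[OF c, of u v] sub by (metis imageI subsetD)
  qed
qed

lemma mat_mult_zero_vec: "(T :: complex mat) \<in> carrier_mat b a \<Longrightarrow> T *\<^sub>v 0\<^sub>v a = 0\<^sub>v b"
  by auto

lemma mat_mult_unit_vec:
  assumes "(T :: complex mat) \<in> carrier_mat b a" "j < a"
  shows "T *\<^sub>v unit_vec a j = col T j"
  using assms by (intro eq_vecI) (auto simp: scalar_prod_right_unit)

lemma subrep_zero: "rep_on X M \<Longrightarrow> subrep X M {0\<^sub>v (deg M)}"
  unfolding subrep_def subspace_iff rep_on_def by (auto simp: mat_mult_zero_vec)

lemma subrep_carrier: "rep_on X M \<Longrightarrow> subrep X M (carrier_vec (deg M))"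
  unfolding subrep_def subspace_iff rep_on_def by auto

text \<open>The equation is solved column by column. It serves both to find right inverses of
  surjections and to factor a map through another one whose image is large enough.\<close>

lemma mat_solve:
  assumes "T \<in> carrier_mat b a" "B \<in> carrier_mat b c"
    and "\<And>j. j < c \<Longrightarrow> \<exists>v\<in>carrier_vec a. T *\<^sub>v v = col B j"
  shows "\<exists>C\<in>carrier_mat a c. T * C = B"
proof -
  obtain f where f: "f j \<in> carrier_vec a" "T *\<^sub>v f j = col B j" if "j < c" for j
    using assms(3) by metis
  define C where "C = mat a c (\<lambda>(i, j). f j $ i)"
  have C: "C \<in> carrier_mat a c" by (simp add: C_def)
  have "col (T * C) j = col B j" if "j < c" for j
  proof -
    have "col C j = f j" using f[OF that] that by (intro eq_vecI) (auto simp: C_def)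
    then show ?thesis using col_mult2[OF assms(1) C that] f(2)[OF that] by (simp only:)
  qed
  then have "T * C = B" using assms C by (intro mat_col_eqI) auto
  with C show ?thesis by auto
qed

lemma mat_cancel_left:
  assumes T: "T \<in> carrier_mat b a" and C: "C \<in> carrier_mat a c" and D: "D \<in> carrier_mat a c"
    and inj: "inj_on ((*\<^sub>v) T) (carrier_vec a)" and "T * C = T * D"
  shows "C = D"
proof (rule mat_col_eqI)
  fix j assume "j < dim_col D"
  then have j: "j < c" using D by auto
  then have "T *\<^sub>v col C j = T *\<^sub>v col D j"
    using assms(5) col_mult2[OF T C j] col_mult2[OF T D j] by simp
  then show "col C j = col D j"
    using inj C D j by (auto dest: inj_onD)
qed (use C D in auto)

lemma mat_kernel_trivial_inj:
  assumes T: "(T :: complex mat) \<in> carrier_mat b a"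
    and ker: "\<And>v. v \<in> carrier_vec a \<Longrightarrow> T *\<^sub>v v = 0\<^sub>v b \<Longrightarrow> v = 0\<^sub>v a"
  shows "inj_on ((*\<^sub>v) T) (carrier_vec a)"
proof (rule inj_onI)
  fix u v assume u: "u \<in> carrier_vec a" and v: "v \<in> carrier_vec a" and eq: "T *\<^sub>v u = T *\<^sub>v v"
  have "T *\<^sub>v (u - v) = 0\<^sub>v b"
    using T u v eq by (simp add: mult_minus_distrib_mat_vec)
  then have "u - v = 0\<^sub>v a" using ker u v by simp
  show "u = v"
  proof (rule eq_vecI)
    fix i assume "i < dim_vec v"
    then have "(u - v) $ i = 0" using \<open>u - v = 0\<^sub>v a\<close> v by simp
    then show "u $ i = v $ i" using u v \<open>i < dim_vec v\<close> by simp
  qed (use u v in simp)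
qed

lemma mat_bij_inverse:
  assumes T: "(T :: complex mat) \<in> carrier_mat b a" and inj: "inj_on ((*\<^sub>v) T) (carrier_vec a)"
    and surj: "(*\<^sub>v) T ` carrier_vec a = carrier_vec b"
  shows "\<exists>R\<in>carrier_mat a b. T * R = 1\<^sub>m b \<and> R * T = 1\<^sub>m a"
proof -
  have "\<exists>v\<in>carrier_vec a. T *\<^sub>v v = col (1\<^sub>m b) j" if "j < b" for j
  proof -
    have "col (1\<^sub>m b) j \<in> (*\<^sub>v) T ` carrier_vec a" unfolding surj using that by simp
    then show ?thesis by (metis (no_types, lifting) imageE)
  qed
  then obtain R where R: "R \<in> carrier_mat a b" "T * R = 1\<^sub>m b"
    using mat_solve[OF T one_carrier_mat] by metis
  have "T * (R * T) = T * 1\<^sub>m a"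
    using assoc_mult_mat[OF T R(1) T] by (simp add: R(2) left_mult_one_mat[OF T] right_mult_one_mat[OF T])
  then have "R * T = 1\<^sub>m a" using mat_cancel_left[OF T _ _ inj] R T by (metis mult_carrier_mat one_carrier_mat)
  with R show ?thesis by auto
qed

text \<open>Kernel and image of \<open>T\<close> are subrepresentations; as \<open>T\<close> is
  nonzero, simplicity leaves the zero kernel and the full image.\<close>

lemma schur_invertible:
  assumes T: "T \<in> intertwiners X M N" and M: "rep_on X M" and N: "rep_on X N"
    and simple: "simple_rep X M" "simple_rep X N" and nz: "T \<noteq> 0\<^sub>m (deg N) (deg M)"
  shows "\<exists>R\<in>carrier_mat (deg M) (deg N). T * R = 1\<^sub>m (deg N) \<and> R * T = 1\<^sub>m (deg M)"
proof -
  note c = intertwinersD(1)[OF T]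
  have nz': "\<exists>v\<in>carrier_vec (deg M). T *\<^sub>v v \<noteq> 0\<^sub>v (deg N)"
  proof (rule ccontr)
    assume a: "\<not> ?thesis"
    have "T = 0\<^sub>m (deg N) (deg M)"
    proof (rule mat_col_eqI)
      fix j assume "j < dim_col (0\<^sub>m (deg N) (deg M) :: complex mat)"
      then have j: "j < deg M" by simp
      have "T *\<^sub>v unit_vec (deg M) j = col T j" using c j by (simp add: mat_mult_unit_vec[OF c])
      then show "col T j = col (0\<^sub>m (deg N) (deg M)) j" using a j by auto
    qed (use c in auto)
    with nz show False by simp
  qed
  have "{v \<in> carrier_vec (deg M). T *\<^sub>v v \<in> {0\<^sub>v (deg N)}} = {0\<^sub>v (deg M)}"
    using subrep_preimage[OF T M N subrep_zero[OF N]] simple(1) nz' by (auto simp: simple_rep_def)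
  then have "inj_on ((*\<^sub>v) T) (carrier_vec (deg M))"
    by (intro mat_kernel_trivial_inj[OF c]) auto
  moreover have "(*\<^sub>v) T ` carrier_vec (deg M) = carrier_vec (deg N)"
    using subrep_image[OF T M N subrep_carrier[OF M]] simple(2) nz' by (auto simp: simple_rep_def)
  ultimately show ?thesis by (rule mat_bij_inverse[OF c])
qed

text \<open>An eigenvalue exists over the complex numbers, and its eigenspace is a nonzero
  subrepresentation, hence everything.\<close>

lemma schur_scalar:
  assumes T: "T \<in> intertwiners X M M" and M: "rep_on X M" and simple: "simple_rep X M"
  shows "\<exists>c. T = c \<cdot>\<^sub>m 1\<^sub>m (deg M)"
proof -
  let ?d = "deg M"
  note c = intertwinersD(1)[OF T]
  have "?d \<noteq> 0" using simple by (simp add: simple_rep_def)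
  then obtain e where "eigenvalue T e" using spectrum_non_empty[OF c] by (auto simp: spectrum_def)
  then obtain u where u: "u \<in> carrier_vec ?d" "u \<noteq> 0\<^sub>v ?d" "T *\<^sub>v u = e \<cdot>\<^sub>v u"
    using c by (auto simp: eigenvalue_def eigenvector_def)
  let ?U = "{v \<in> carrier_vec ?d. T *\<^sub>v v = e \<cdot>\<^sub>v v}"
  have "subrep X M ?U"
    unfolding subrep_def subspace_iff
  proof (intro conjI ballI allI)
    show "0\<^sub>v ?d \<in> ?U" using c by auto
    fix v assume v: "v \<in> ?U"
    show "w + v \<in> ?U" if "w \<in> ?U" for w
      using v that c by (simp add: mult_add_distrib_mat_vec[OF c] smult_add_distrib_vec[of _ ?d])
    show "a \<cdot>\<^sub>v v \<in> ?U" for a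
      using v by (simp add: mult_mat_vec[OF c] smult_smult_assoc mult.commute)
    show "act M x *\<^sub>v v \<in> ?U" if "x \<in> X" for x
    proof -
      have ac: "act M x \<in> carrier_mat ?d ?d" using M that by (simp add: rep_on_def)
      then show ?thesis using v intertwiner_vec[OF T M M that] by (simp add: mult_mat_vec[OF ac])
    qed
  qed auto
  then have "?U = carrier_vec ?d" using simple u by (auto simp: simple_rep_def)
  then have all: "T *\<^sub>v v = e \<cdot>\<^sub>v v" if "v \<in> carrier_vec ?d" for v using that by auto
  have "T = e \<cdot>\<^sub>m 1\<^sub>m ?d"
  proof (rule mat_col_eqI)
    fix j assume "j < dim_col (e \<cdot>\<^sub>m 1\<^sub>m ?d)"
    then have j: "j < ?d" by simp
    then have "col T j = T *\<^sub>v unit_vec ?d j" using c by (simp add: mat_mult_unit_vec[OF c])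
    also have "\<dots> = e \<cdot>\<^sub>v unit_vec ?d j" using all by simp
    finally show "col T j = col (e \<cdot>\<^sub>m 1\<^sub>m ?d) j" using j by simp
  qed (use c in auto)
  then show ?thesis by auto
qed

section \<open>Traces, averages over the group and orthogonality of characters\<close>

definition mat_trace :: "complex mat \<Rightarrow> complex" where
  "mat_trace B = (\<Sum>i<dim_row B. B $$ (i, i))"

lemma mat_trace_comm:
  assumes "B \<in> carrier_mat a b" "C \<in> carrier_mat b a"
  shows "mat_trace (B * C) = mat_trace (C * B)"
proof -
  have "mat_trace (B * C) = (\<Sum>i<a. \<Sum>j<b. B $$ (i, j) * C $$ (j, i))"
    using assms by (simp add: mat_trace_def scalar_prod_def lessThan_atLeast0)
  also have "\<dots> = (\<Sum>j<b. \<Sum>i<a. C $$ (j, i) * B $$ (i, j))"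
    by (subst sum.swap) (simp add: mult.commute)
  also have "\<dots> = mat_trace (C * B)"
    using assms by (simp add: mat_trace_def scalar_prod_def lessThan_atLeast0)
  finally show ?thesis .
qed

lemma mat_trace_conj:
  assumes "T \<in> carrier_mat b a" "R \<in> carrier_mat a b" "T * R = 1\<^sub>m b" "R * T = 1\<^sub>m a"
    and "B \<in> carrier_mat a a" "C \<in> carrier_mat b b" "T * B = C * T"
  shows "mat_trace B = mat_trace C"
proof -
  have "C = C * (T * R)" using assms by simp
  also have "\<dots> = T * B * R" using assms by (simp add: assoc_mult_mat[symmetric, of _ b b _ a _ b])
  finally have "mat_trace C = mat_trace (T * B * R)" by simp
  also have "\<dots> = mat_trace (R * (T * B))"
    using assms by (intro mat_trace_comm[of _ b a]) auto
  also have "R * (T * B) = B"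
    using assoc_mult_mat[OF assms(2,1,5)] assms(4,5) by simp
  finally show ?thesis by simp
qed

lemma rep_iso_trace:
  assumes "rep_iso X M N" "x \<in> X" "act M x \<in> carrier_mat (deg M) (deg M)" "act N x \<in> carrier_mat (deg N) (deg N)"
  shows "mat_trace (act M x) = mat_trace (act N x)"
proof -
  obtain T where T: "T \<in> intertwiners X M N" "invertible_mat T" using assms by (auto simp: rep_iso_def)
  note c = intertwinersD[OF T(1)]
  obtain R where R: "square_mat T" "inverts_mat T R" "inverts_mat R T"
    using T(2) by (auto simp: invertible_mat_def)
  have "dim_row R = deg M" "dim_col R = deg N"
    using R c(1) by (auto simp: inverts_mat_def dest: arg_cong[of _ _ dim_col] arg_cong[of _ _ dim_row])
  then have "R \<in> carrier_mat (deg M) (deg N)" "T * R = 1\<^sub>m (deg N)" "R * T = 1\<^sub>m (deg M)"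
    using R c(1) by (auto simp: inverts_mat_def)
  then show ?thesis using mat_trace_conj c assms by metis
qed

lemma rep_isoI:
  assumes "T \<in> intertwiners X M N" "R \<in> carrier_mat (deg M) (deg N)" "T * R = 1\<^sub>m (deg N)" "R * T = 1\<^sub>m (deg M)"
  shows "rep_iso X M N"
proof -
  note c = intertwinersD(1)[OF assms(1)]
  \<comment> \<open>\<open>invertible_mat\<close> asks for a square matrix; the traces of the two
    identity matrices show that the degrees agree.\<close>
  have "mat_trace (T * R) = mat_trace (R * T)" using c assms(2) by (rule mat_trace_comm)
  then have "deg M = deg N" by (simp add: assms(3,4) mat_trace_def)
  then have "invertible_mat T"
    using c assms by (auto simp: invertible_mat_def inverts_mat_def)
  with assms(1) show ?thesis by (auto simp: rep_iso_def)
qed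

text \<open>The sizes are arguments because the summands of an empty sum could not determine
  them.\<close>

definition mat_sum :: "nat \<Rightarrow> nat \<Rightarrow> 's set \<Rightarrow> ('s \<Rightarrow> complex mat) \<Rightarrow> complex mat" where
  "mat_sum a b F f = mat a b (\<lambda>(i, j). \<Sum>s\<in>F. f s $$ (i, j))"

lemma mat_sum_carrier [simp]: "mat_sum a b F f \<in> carrier_mat a b"
  by (simp add: mat_sum_def)

lemma mat_sum_cong: "(\<And>s. s \<in> F \<Longrightarrow> f s = g s) \<Longrightarrow> mat_sum a b F f = mat_sum a b F g"
  by (auto simp: mat_sum_def intro!: eq_matI sum.cong)

lemma mat_sum_mult_left:
  assumes "B \<in> carrier_mat c a" "\<And>s. s \<in> F \<Longrightarrow> f s \<in> carrier_mat a b"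
  shows "B * mat_sum a b F f = mat_sum c b F (\<lambda>s. B * f s)"
proof (rule eq_matI)
  fix i j assume "i < dim_row (mat_sum c b F (\<lambda>s. B * f s))" "j < dim_col (mat_sum c b F (\<lambda>s. B * f s))"
  then have ij: "i < c" "j < b" by (auto simp: mat_sum_def)
  have "(B * mat_sum a b F f) $$ (i, j) = (\<Sum>k<a. \<Sum>s\<in>F. B $$ (i, k) * f s $$ (k, j))"
    using ij assms(1) by (simp add: mat_sum_def scalar_prod_def lessThan_atLeast0 sum_distrib_left)
  also have "\<dots> = (\<Sum>s\<in>F. \<Sum>k<a. B $$ (i, k) * f s $$ (k, j))" by (rule sum.swap)
  also have "\<dots> = (\<Sum>s\<in>F. (B * f s) $$ (i, j))"
    using ij assms by (intro sum.cong refl) (fastforce simp: scalar_prod_def lessThan_atLeast0)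
  finally show "(B * mat_sum a b F f) $$ (i, j) = mat_sum c b F (\<lambda>s. B * f s) $$ (i, j)"
    using ij by (simp add: mat_sum_def)
qed (use assms in \<open>auto simp: mat_sum_def\<close>)

lemma mat_sum_mult_right:
  assumes "B \<in> carrier_mat b c" "\<And>s. s \<in> F \<Longrightarrow> f s \<in> carrier_mat a b"
  shows "mat_sum a b F f * B = mat_sum a c F (\<lambda>s. f s * B)"
proof (rule eq_matI)
  fix i j assume "i < dim_row (mat_sum a c F (\<lambda>s. f s * B))" "j < dim_col (mat_sum a c F (\<lambda>s. f s * B))"
  then have ij: "i < a" "j < c" by (auto simp: mat_sum_def)
  have "(mat_sum a b F f * B) $$ (i, j) = (\<Sum>k<b. \<Sum>s\<in>F. f s $$ (i, k) * B $$ (k, j))"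
    using ij assms(1) by (simp add: mat_sum_def scalar_prod_def lessThan_atLeast0 sum_distrib_right)
  also have "\<dots> = (\<Sum>s\<in>F. \<Sum>k<b. f s $$ (i, k) * B $$ (k, j))" by (rule sum.swap)
  also have "\<dots> = (\<Sum>s\<in>F. (f s * B) $$ (i, j))"
    using ij assms by (intro sum.cong refl) (fastforce simp: scalar_prod_def lessThan_atLeast0)
  finally show "(mat_sum a b F f * B) $$ (i, j) = mat_sum a c F (\<lambda>s. f s * B) $$ (i, j)"
    using ij by (simp add: mat_sum_def)
qed (use assms in \<open>auto simp: mat_sum_def\<close>)

lemma mat_sum_reindex:
  assumes "bij_betw \<phi> F F" shows "mat_sum a b F (\<lambda>s. f (\<phi> s)) = mat_sum a b F f"
  unfolding mat_sum_def
proof (rule cong_mat)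
  fix i j
  show "(case (i, j) of (i, j) \<Rightarrow> \<Sum>s\<in>F. f (\<phi> s) $$ (i, j)) = (case (i, j) of (i, j) \<Rightarrow> \<Sum>s\<in>F. f s $$ (i, j))"
    using sum.reindex_bij_betw[OF assms, of "\<lambda>s. f s $$ (i, j)"] by simp
qed simp_all

lemma mat_trace_sum: "mat_trace (mat_sum a a F f) = (\<Sum>s\<in>F. \<Sum>i<a. f s $$ (i, i))"
  by (simp add: mat_trace_def mat_sum_def sum.swap[of _ "{..<a}"])

definition unit_mat :: "nat \<Rightarrow> nat \<Rightarrow> nat \<Rightarrow> nat \<Rightarrow> complex mat" where
  "unit_mat a b i j = mat a b (\<lambda>(k, l). if k = i \<and> l = j then 1 else 0)"

lemma unit_mat_sandwich:
  assumes "B \<in> carrier_mat a a" "C \<in> carrier_mat b b" "i < a" "j < b"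
  shows "(B * unit_mat a b i j * C) $$ (i, j) = B $$ (i, i) * C $$ (j, j)"
proof -
  have "(B * unit_mat a b i j) $$ (i, l) = (if l = j then B $$ (i, i) else 0)" if "l < b" for l
  proof -
    have "(B * unit_mat a b i j) $$ (i, l) = (\<Sum>k<a. B $$ (i, k) * (if k = i \<and> l = j then 1 else 0))"
      using assms that by (simp add: unit_mat_def scalar_prod_def lessThan_atLeast0)
    also have "\<dots> = (\<Sum>k<a. if k = i then (if l = j then B $$ (i, i) else 0) else 0)"
      by (intro sum.cong) auto
    finally show ?thesis using assms by simp
  qed
  then have "(B * unit_mat a b i j * C) $$ (i, j) = (\<Sum>l<b. (if l = j then B $$ (i, i) else 0) * C $$ (l, j))"
    using assms by (simp add: unit_mat_def scalar_prod_def lessThan_atLeast0)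
  also have "\<dots> = (\<Sum>l<b. if l = j then B $$ (i, i) * C $$ (j, j) else 0)"
    by (intro sum.cong) auto
  finally show ?thesis using assms by simp
qed

context finite_matrix_group
begin

lemma rep_on: "group_rep (GL_sub m H) M \<Longrightarrow> rep_on H M"
  by (simp add: rep_on_def rep_mat)

text \<open>The factor \<open>1 / card H\<close> is left out here; it appears in
  \<open>equivariant_section\<close>, where the scale matters.\<close>

definition average :: "complex mat rep \<Rightarrow> complex mat rep \<Rightarrow> complex mat \<Rightarrow> complex mat" where
  "average M N R = mat_sum (deg N) (deg M) H (\<lambda>h. act N h * R * act M (ginv h))"

text \<open>Left translation by \<open>g\<close> permutes the summands, and
  \<open>ginv (g * h) * g\<close> equals \<open>ginv h\<close>.\<close>

lemma average_intertwiner: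
  assumes M: "group_rep (GL_sub m H) M" and N: "group_rep (GL_sub m H) N" and R: "R \<in> carrier_mat (deg N) (deg M)"
  shows "average M N R \<in> intertwiners H M N"
  unfolding intertwiners_def
proof (intro CollectI conjI ballI)
  let ?a = "deg N" and ?b = "deg M"
  note Mc = rep_mat[OF M] and Nc = rep_mat[OF N]
  show "average M N R \<in> carrier_mat ?a ?b" by (simp add: average_def)
  fix g assume g: "g \<in> H"
  have term_mat: "act N h * R * act M (ginv h) \<in> carrier_mat ?a ?b" if "h \<in> H" for h
    using Mc[of "ginv h"] Nc[of h] R that by simp
  have "average M N R * act M g = mat_sum ?a ?b H (\<lambda>h. act N h * R * act M (ginv h) * act M g)"
    unfolding average_def using Mc[OF g] term_mat by (rule mat_sum_mult_right)
  also have "\<dots> = mat_sum ?a ?b H (\<lambda>h. act N (g * h) * R * act M (ginv (g * h)) * act M g)"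
    using mat_sum_reindex[OF translate[OF g], of ?a ?b "\<lambda>h. act N h * R * act M (ginv h) * act M g"] by simp
  also have "\<dots> = mat_sum ?a ?b H (\<lambda>h. act N g * (act N h * R * act M (ginv h)))"
  proof (rule mat_sum_cong)
    fix h assume h: "h \<in> H"
    have "ginv (g * h) * g = ginv (g * h) * (g * (h * ginv h))"
      using g h by (simp add: right_mult_one_mat[OF mat])
    also have "\<dots> = ginv (g * h) * (g * h) * ginv h"
      using g h by (simp only: assoc_mult_mat[of _ m m _ m _ m] mat mult ginv(1))
    also have "\<dots> = ginv h" using g h ginv(2)[of "g * h"] by (simp add: left_mult_one_mat[OF mat])
    finally have eq: "act M (ginv (g * h)) * act M g = act M (ginv h)"
      using rep_mult[OF M, of "ginv (g * h)" g] g h by simp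
    have "act N (g * h) * R * act M (ginv (g * h)) * act M g = act N (g * h) * R * (act M (ginv (g * h)) * act M g)"
      using g h R Mc[of g] Mc[of "ginv (g * h)"] Nc[of "g * h"] by (intro assoc_mult_mat) auto
    also have "\<dots> = act N g * act N h * R * act M (ginv h)"
      using g h by (simp add: eq rep_mult[OF N])
    also have "\<dots> = act N g * (act N h * R * act M (ginv h))"
      using g h R Mc[of "ginv h"] Nc[of h] Nc[of g]
      by (simp add: assoc_mult_mat[of _ ?a ?a _ ?a _ ?b] assoc_mult_mat[of _ ?a ?a _ ?b _ ?b])
    finally show "act N (g * h) * R * act M (ginv (g * h)) * act M g = act N g * (act N h * R * act M (ginv h))" .
  qed
  also have "\<dots> = act N g * average M N R"
    unfolding average_def using Nc[OF g] term_mat by (rule mat_sum_mult_left[symmetric])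
  finally show "average M N R * act M g = act N g * average M N R" .
qed

text \<open>By \<open>unit_mat_sandwich\<close>, conjugated matrix units contain the products of
  diagonal entries. Sums of products of characters thus become entries of intertwiners, which
  Schur's lemma controls. Values at \<open>ginv h\<close> stand in for complex conjugates, so no
  invariant inner product has to be introduced.\<close>

lemma character_product:
  assumes M: "group_rep (GL_sub m H) M" and N: "group_rep (GL_sub m H) N"
  shows "(\<Sum>h\<in>H. mat_trace (act N h) * mat_trace (act M (ginv h))) =
    (\<Sum>i<deg N. \<Sum>j<deg M. average M N (unit_mat (deg N) (deg M) i j) $$ (i, j))"
proof -
  have "mat_trace (act N h) * mat_trace (act M (ginv h)) =
      (\<Sum>i<deg N. \<Sum>j<deg M. (act N h * unit_mat (deg N) (deg M) i j * act M (ginv h)) $$ (i, j))" if h: "h \<in> H" for h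
  proof -
    note hc = rep_mat[OF N h] rep_mat[OF M ginv(1)[OF h]]
    have "(act N h * unit_mat (deg N) (deg M) i j * act M (ginv h)) $$ (i, j) = act N h $$ (i, i) * act M (ginv h) $$ (j, j)"
      if "i < deg N" "j < deg M" for i j
      using hc that by (rule unit_mat_sandwich)
    then show ?thesis using hc by (simp add: mat_trace_def sum_product del: index_mult_mat)
  qed
  then have "(\<Sum>h\<in>H. mat_trace (act N h) * mat_trace (act M (ginv h))) =
      (\<Sum>h\<in>H. \<Sum>i<deg N. \<Sum>j<deg M. (act N h * unit_mat (deg N) (deg M) i j * act M (ginv h)) $$ (i, j))"
    by (intro sum.cong) auto
  also have "\<dots> = (\<Sum>i<deg N. \<Sum>j<deg M. \<Sum>h\<in>H. (act N h * unit_mat (deg N) (deg M) i j * act M (ginv h)) $$ (i, j))"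
    by (simp only: sum.swap[of _ _ H])
  also have "\<dots> = (\<Sum>i<deg N. \<Sum>j<deg M. average M N (unit_mat (deg N) (deg M) i j) $$ (i, j))"
    by (simp add: average_def mat_sum_def)
  finally show ?thesis .
qed

lemma character_orthogonal:
  assumes M: "group_rep (GL_sub m H) M" and N: "group_rep (GL_sub m H) N"
    and simple: "simple_rep H M" "simple_rep H N" and niso: "\<not> rep_iso H M N"
  shows "(\<Sum>h\<in>H. mat_trace (act N h) * mat_trace (act M (ginv h))) = 0"
proof -
  have "average M N R = 0\<^sub>m (deg N) (deg M)" if "R \<in> carrier_mat (deg N) (deg M)" for R
    using schur_invertible[OF average_intertwiner[OF M N that] rep_on[OF M] rep_on[OF N] simple]
      rep_isoI[OF average_intertwiner[OF M N that]] niso by blast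
  then show ?thesis
    unfolding character_product[OF M N] by (simp add: unit_mat_def)
qed

text \<open>By Schur's lemma the average of a matrix unit is a scalar matrix. Its off-diagonal
  entries are 0, and for \<open>i = j\<close> its trace is \<open>card H\<close>; summing over the
  diagonal positions gives \<open>card H\<close> in total.\<close>

lemma character_norm_nonzero:
  assumes M: "group_rep (GL_sub m H) M" and simple: "simple_rep H M"
  shows "(\<Sum>h\<in>H. mat_trace (act M h) * mat_trace (act M (ginv h))) \<noteq> 0"
proof -
  let ?d = "deg M" and ?E = "unit_mat (deg M) (deg M)"
  have d: "?d > 0" using simple by (simp add: simple_rep_def)
  have "average M M (?E i j) $$ (i, j) = (if i = j then of_nat (card H) / of_nat ?d else 0)"
    if i: "i < ?d" and j: "j < ?d" for i j
  proof -
    have E: "?E i j \<in> carrier_mat ?d ?d" by (simp add: unit_mat_def)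
    obtain c where c: "average M M (?E i j) = c \<cdot>\<^sub>m 1\<^sub>m ?d"
      using schur_scalar[OF average_intertwiner[OF M M E] rep_on[OF M] simple] by auto
    show ?thesis
    proof (cases "i = j")
      case True
      have "mat_trace (act M h * ?E i j * act M (ginv h)) = 1" if h: "h \<in> H" for h
      proof -
        note hc = rep_mat[OF M h] rep_mat[OF M ginv(1)[OF h]]
        have "mat_trace (act M h * ?E i j * act M (ginv h)) = mat_trace (act M (ginv h) * (act M h * ?E i j))"
          using hc E by (intro mat_trace_comm[of _ ?d ?d]) auto
        also have "act M (ginv h) * (act M h * ?E i j) = ?E i j"
          using hc E h by (simp add: assoc_mult_mat[symmetric, of _ ?d ?d _ ?d _ ?d] rep_ginv[OF M])
        also have "mat_trace (?E i j) = (\<Sum>k<?d. if k = i then 1 else 0)"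
          using True by (auto simp: mat_trace_def unit_mat_def intro!: sum.cong)
        finally show ?thesis using i by simp
      qed
      moreover have "mat_trace B = (\<Sum>k<?d. B $$ (k, k))" if "B \<in> carrier_mat ?d ?d" for B
        using that by (simp add: mat_trace_def)
      moreover have "act M h * ?E i j * act M (ginv h) \<in> carrier_mat ?d ?d" if "h \<in> H" for h
        using rep_mat[OF M that] rep_mat[OF M ginv(1)[OF that]] E by simp
      ultimately have "mat_trace (average M M (?E i j)) = of_nat (card H)"
        unfolding average_def mat_trace_sum by simp
      moreover have "mat_trace (c \<cdot>\<^sub>m 1\<^sub>m ?d) = of_nat ?d * c"
        by (simp add: mat_trace_def)
      ultimately show ?thesis using True c i d by (simp add: field_simps)
    qed (use c i j in simp)
  qed
  then have "(\<Sum>h\<in>H. mat_trace (act M h) * mat_trace (act M (ginv h))) = of_nat (card H)"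
    unfolding character_product[OF M M] using d by simp
  moreover have "card H \<noteq> 0" using finite one by (metis card_0_eq empty_iff)
  ultimately show ?thesis by simp
qed

text \<open>Pairing the relation with the values of the character of \<open>S l\<close> at inverses
  isolates \<open>c l\<close> times a nonzero number.\<close>

lemma characters_independent:
  fixes n :: nat
  assumes S: "\<And>j. j < n \<Longrightarrow> group_rep (GL_sub m H) (S j) \<and> simple_rep H (S j)"
    and niso: "\<And>i j. i < n \<Longrightarrow> j < n \<Longrightarrow> rep_iso H (S i) (S j) \<Longrightarrow> i = j"
    and zero: "\<And>g. g \<in> H \<Longrightarrow> (\<Sum>j<n. c j * mat_trace (act (S j) g)) = 0"
    and l: "l < n"
  shows "c l = 0"
proof -
  let ?\<chi> = "\<lambda>j g. mat_trace (act (S j) g)"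
  have "0 = (\<Sum>g\<in>H. (\<Sum>j<n. c j * ?\<chi> j g) * ?\<chi> l (ginv g))"
    using zero by simp
  also have "\<dots> = (\<Sum>j<n. c j * (\<Sum>g\<in>H. ?\<chi> j g * ?\<chi> l (ginv g)))"
    by (simp add: sum_distrib_left sum_distrib_right sum.swap[of _ _ H] mult_ac)
  also have "\<dots> = (\<Sum>j<n. if j = l then c l * (\<Sum>g\<in>H. ?\<chi> l g * ?\<chi> l (ginv g)) else 0)"
    using S niso l by (intro sum.cong refl) (auto intro!: character_orthogonal)
  also have "\<dots> = c l * (\<Sum>g\<in>H. ?\<chi> l g * ?\<chi> l (ginv g))" using l by simp
  finally show ?thesis using character_norm_nonzero S l by auto
qed

end

section \<open>Traces of tensor products and of direct sums\<close>

lemma mat_trace_kronecker: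
  assumes "B \<in> carrier_mat a a" "C \<in> carrier_mat b b"
  shows "mat_trace (kronecker B C) = mat_trace B * mat_trace C"
proof -
  have "mat_trace (kronecker B C) = (\<Sum>k<a * b. B $$ (k div b, k div b) * C $$ (k mod b, k mod b))"
    using assms by (simp add: mat_trace_def kronecker_def)
  also have "\<dots> = (\<Sum>i<a. \<Sum>k\<in>{i * b..<i * b + b}. B $$ (k div b, k div b) * C $$ (k mod b, k mod b))"
    by (rule sum.nat_group[symmetric])
  also have "\<dots> = (\<Sum>i<a. \<Sum>j<b. B $$ (i, i) * C $$ (j, j))"
  proof (rule sum.cong[OF refl])
    fix i
    have eq: "k div b = i" "k mod b = k - i * b" if "k \<in> {i * b..<i * b + b}" for k
    proof -
      show "k div b = i" using that by (intro div_nat_eqI) (auto simp: mult.commute)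
      then show "k mod b = k - i * b" using minus_div_mult_eq_mod[of k b] by simp
    qed
    show "(\<Sum>k\<in>{i * b..<i * b + b}. B $$ (k div b, k div b) * C $$ (k mod b, k mod b)) = (\<Sum>j<b. B $$ (i, i) * C $$ (j, j))"
      by (rule sum.reindex_bij_witness[where i = "\<lambda>j. i * b + j" and j = "\<lambda>k. k - i * b"])
        (auto simp: eq)
  qed
  finally show ?thesis using assms by (simp add: mat_trace_def sum_product)
qed

lemma mat_trace_four_block:
  assumes "B \<in> carrier_mat a a" "C \<in> carrier_mat b b"
  shows "mat_trace (four_block_mat B (0\<^sub>m a b) (0\<^sub>m b a) C) = mat_trace B + mat_trace C"
proof -
  have "mat_trace (four_block_mat B (0\<^sub>m a b) (0\<^sub>m b a) C) =
      (\<Sum>i<a + b. if i < a then B $$ (i, i) else C $$ (i - a, i - a))"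
    using carrier_matD[OF assms(1)] carrier_matD[OF assms(2)] by (auto simp: mat_trace_def intro!: sum.cong)
  also have "{..<a + b} = {..<a} \<union> {a..<a + b}" by auto
  also have "(\<Sum>i\<in>{..<a} \<union> {a..<a + b}. if i < a then B $$ (i, i) else C $$ (i - a, i - a)) =
      (\<Sum>i<a. B $$ (i, i)) + (\<Sum>i\<in>{a..<a + b}. C $$ (i - a, i - a))"
    by (subst sum.union_disjoint) auto
  also have "(\<Sum>i\<in>{a..<a + b}. C $$ (i - a, i - a)) = (\<Sum>i<b. C $$ (i, i))"
    by (rule sum.reindex_bij_witness[where i = "\<lambda>i. i + a" and j = "\<lambda>i. i - a"]) auto
  finally show ?thesis using assms by (simp add: mat_trace_def)
qed

lemma mat_trace_diag_block:
  assumes "\<And>B. B \<in> set Bs \<Longrightarrow> square_mat B"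
  shows "mat_trace (diag_block_mat Bs) = sum_list (map mat_trace Bs)"
  using assms
proof (induction Bs)
  case (Cons B Bs)
  let ?D = "diag_block_mat Bs"
  have sq: "square_mat B" "square_mat ?D" using Cons.prems diag_block_mat_square[of Bs] by auto
  then have "mat_trace (four_block_mat B (0\<^sub>m (dim_row B) (dim_col ?D)) (0\<^sub>m (dim_row ?D) (dim_col B)) ?D) = mat_trace B + mat_trace ?D"
  proof -
    have dims: "dim_col B = dim_row B" "dim_col ?D = dim_row ?D" using sq by auto
    from mat_trace_four_block[OF carrier_matI[OF refl dims(1)] carrier_matI[OF refl dims(2)]]
    show ?thesis by (simp only: dims)
  qed
  then show ?case using Cons by (simp add: Let_def)
qed (simp add: mat_trace_def)

text \<open>Stated over an arbitrary commutative semiring since it is applied both to block sizes,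
  which are natural numbers, and to complex traces.\<close>

lemma sum_list_concat_replicate:
  "sum_list (map f (concat (map (\<lambda>j. replicate (a j) (x j)) [0..<n]))) = (\<Sum>j<n. of_nat (a j) * f (x j))"
  for f :: "'z \<Rightarrow> 'y :: comm_semiring_1"
proof (induction n)
  case (Suc n)
  have "sum_list (replicate k y) = of_nat k * y" for k and y :: 'y
    by (induction k) (simp_all add: algebra_simps)
  with Suc show ?case by simp
qed simp

lemma
  assumes "\<And>j. j < n \<Longrightarrow> act (S j) g \<in> carrier_mat (deg (S j)) (deg (S j))"
  shows sum_rep_carrier: "act (sum_rep n a S) g \<in> carrier_mat (deg (sum_rep n a S)) (deg (sum_rep n a S))"
    and sum_rep_trace: "mat_trace (act (sum_rep n a S) g) = (\<Sum>j<n. of_nat (a j) * mat_trace (act (S j) g))"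
proof -
  let ?L = "concat (map (\<lambda>j. replicate (a j) (act (S j) g)) [0..<n])"
  have "sum_list (map dim_row ?L) = (\<Sum>j<n. a j * dim_row (act (S j) g))"
    "sum_list (map dim_col ?L) = (\<Sum>j<n. a j * dim_col (act (S j) g))"
    by (subst sum_list_concat_replicate, simp)+
  then show "act (sum_rep n a S) g \<in> carrier_mat (deg (sum_rep n a S)) (deg (sum_rep n a S))"
    using carrier_matD[OF assms] by (intro carrier_matI) (auto simp: sum_rep_def dim_diag_block_mat intro!: sum.cong)
  have "mat_trace (diag_block_mat ?L) = sum_list (map mat_trace ?L)"
    using assms by (intro mat_trace_diag_block) fastforce
  then show "mat_trace (act (sum_rep n a S) g) = (\<Sum>j<n. of_nat (a j) * mat_trace (act (S j) g))"
    unfolding sum_list_concat_replicate by (simp add: sum_rep_def)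
qed

section \<open>The socle of a projective cover\<close>

text \<open>A submodule of the image is the image of its preimage, and the preimage is trivial or
  everything by simplicity. The left inverse \<open>L\<close> ensures that the image is
  nonzero.\<close>

lemma simple_subrep_image:
  assumes T: "T \<in> intertwiners X M N" and M: "rep_on X M" and N: "rep_on X N"
    and simple: "simple_rep X M" and L: "L \<in> carrier_mat (deg M) (deg N)" "L * T = 1\<^sub>m (deg M)"
  shows "simple_subrep X N ((*\<^sub>v) T ` carrier_vec (deg M))"
  unfolding simple_subrep_def
proof (intro conjI allI impI)
  note c = intertwinersD(1)[OF T]
  have left: "L *\<^sub>v (T *\<^sub>v v) = v" if "v \<in> carrier_vec (deg M)" for v
    using assoc_mult_mat_vec[OF L(1) c that] that by (simp add: L(2))
  show "subrep X N ((*\<^sub>v) T ` carrier_vec (deg M))"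
    by (rule subrep_image[OF T M N subrep_carrier[OF M]])
  show "(*\<^sub>v) T ` carrier_vec (deg M) \<noteq> {0\<^sub>v (deg N)}"
  proof
    assume eq: "(*\<^sub>v) T ` carrier_vec (deg M) = {0\<^sub>v (deg N)}"
    have d: "0 < deg M" using simple by (simp add: simple_rep_def)
    let ?u = "unit_vec (deg M) 0 :: complex vec"
    have "T *\<^sub>v ?u = 0\<^sub>v (deg N)" using eq unit_vec_carrier[of "deg M" 0] by blast
    then have "?u = 0\<^sub>v (deg M)" using left[of ?u] mat_mult_zero_vec[OF L(1)] by simp
    then have "?u $ 0 = 0" using d by simp
    then show False using d by simp
  qed
  fix U assume U: "subrep X N U \<and> U \<subseteq> (*\<^sub>v) T ` carrier_vec (deg M)"
  let ?V = "{v \<in> carrier_vec (deg M). T *\<^sub>v v \<in> U}"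
  have "U = (*\<^sub>v) T ` ?V" using U by auto
  moreover have "?V = {0\<^sub>v (deg M)} \<or> ?V = carrier_vec (deg M)"
    using subrep_preimage[OF T M N] U simple by (simp add: simple_rep_def)
  ultimately show "U = {0\<^sub>v (deg N)} \<or> U = (*\<^sub>v) T ` carrier_vec (deg M)"
    using mat_mult_zero_vec[OF c] by auto
qed

lemma simple_subrep_socle:
  assumes "simple_subrep X M U" shows "U \<subseteq> socle X M"
proof -
  interpret vec_module "TYPE(complex)" "deg M" .
  have "\<Union>{U. simple_subrep X M U} \<subseteq> carrier_vec (deg M)"
    by (auto simp: simple_subrep_def subrep_def subspace_iff)
  then have "\<Union>{U. simple_subrep X M U} \<subseteq> span (\<Union>{U. simple_subrep X M U})"
    by (rule in_own_span)
  then show ?thesis using assms by (auto simp: socle_def)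
qed

lemma surjective_matI:
  assumes "T \<in> carrier_mat b a" "R \<in> carrier_mat a b" "T * R = 1\<^sub>m b"
  shows "surjective_mat T"
proof -
  have "v \<in> (*\<^sub>v) T ` carrier_vec a" if v: "v \<in> carrier_vec b" for v
  proof
    show "v = T *\<^sub>v (R *\<^sub>v v)" using assoc_mult_mat_vec[OF assms(1,2) v] v by (simp add: assms(3))
    show "R *\<^sub>v v \<in> carrier_vec a" using assms v by simp
  qed
  then show ?thesis using assms(1) by (auto simp: surjective_mat_def)
qed

lemma ext_action_zero [simp]: "ext_action m g (\<lambda>_. 0) = (\<lambda>_. 0)"
  by (rule ext) (simp add: ext_action_def)

lemma index_mat_cong_kernel:
  assumes "bij_betw e {..<a} B" "bij_betw f {..<b} C" "index_mat a b e f K = X"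
    and "\<And>i j. i \<in> B \<Longrightarrow> j \<in> C \<Longrightarrow> L i j = K i j"
  shows "index_mat a b e f L = X"
  using index_mat_cong[OF assms(1,2,4)] assms(3) by simp

context finite_matrix_group
begin

section \<open>Group elements and the top exterior element inside the skew group algebra\<close>

lemma alg_module_act:
  assumes "alg_module A P"
  shows "x \<in> carrier A \<Longrightarrow> act P x \<in> carrier_mat (deg P) (deg P)"
    and "x \<in> carrier A \<Longrightarrow> y \<in> carrier A \<Longrightarrow> act P (x \<otimes>\<^bsub>A\<^esub> y) = act P x * act P y"
    and "x \<in> carrier A \<Longrightarrow> y \<in> carrier A \<Longrightarrow> act P (x \<oplus>\<^bsub>A\<^esub> y) = act P x + act P y"
    and "act P \<one>\<^bsub>A\<^esub> = 1\<^sub>m (deg P)"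
    and "x \<in> carrier A \<Longrightarrow> act P (c \<odot>\<^bsub>A\<^esub> x) = c \<cdot>\<^sub>m act P x"
  using assms by (auto simp: alg_module_def Ring.ring_hom_def ring_mat_simps)

lemma alg_module_rep_on: "alg_module A P \<Longrightarrow> rep_on (carrier A) P"
  using alg_module_act(1) by (simp add: rep_on_def)

lemma skew_mult_closed:
  assumes x: "x \<in> carrier A" and y: "y \<in> carrier A" shows "x \<otimes>\<^bsub>A\<^esub> y \<in> carrier A"
  unfolding skew_mult[OF assms] skew_carrier
  using skew_carrierD[OF x] skew_carrierD[OF y]
  by (auto simp: split_def intro!: ext_sum_closed ext_mult_closed ext_action_closed)

lemma skew_add_closed: "x \<in> carrier A \<Longrightarrow> y \<in> carrier A \<Longrightarrow> x \<oplus>\<^bsub>A\<^esub> y \<in> carrier A"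
  using skew_carrierD by (auto simp: skew_add skew_carrier intro!: ext_add_closed)

lemma skew_smult_closed: "x \<in> carrier A \<Longrightarrow> c \<odot>\<^bsub>A\<^esub> x \<in> carrier A"
  using skew_carrierD by (auto simp: skew_smult skew_carrier intro!: ext_scale_closed)

lemma skew_one_closed: "\<one>\<^bsub>A\<^esub> \<in> carrier A"
  by (auto simp: skew_one skew_carrier ext_one_closed ext_zero_closed)

text \<open>This is the copy of the group algebra of \<open>H\<close> inside the skew group algebra:
  all coefficients lie in exterior degree zero.\<close>

definition group_combination :: "(complex mat \<Rightarrow> complex) \<Rightarrow> complex mat \<Rightarrow> nat set \<Rightarrow> complex" where
  "group_combination c = (\<lambda>k\<in>H. \<lambda>I. c k * ext_one I)"

definition group_element :: "complex mat \<Rightarrow> complex mat \<Rightarrow> nat set \<Rightarrow> complex" where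
  "group_element g = group_combination (\<lambda>k. if k = g then 1 else 0)"

definition top_element :: "complex mat \<Rightarrow> nat set \<Rightarrow> complex" where
  "top_element = (\<lambda>k\<in>H. if k = 1\<^sub>m m then ext_basis {..<m} else (\<lambda>_. 0))"

lemma group_combination_closed [simp]: "group_combination c \<in> carrier A"
  by (auto simp: group_combination_def skew_carrier intro!: ext_scale_closed ext_one_closed)

lemma group_element_closed [simp]: "group_element g \<in> carrier A"
  by (simp add: group_element_def)

lemma top_element_closed [simp]: "top_element \<in> carrier A"
  by (auto simp: top_element_def skew_carrier intro!: ext_basis_closed ext_zero_closed)

lemma group_element_one: "group_element (1\<^sub>m m) = \<one>\<^bsub>A\<^esub>"
  by (auto simp: group_element_def group_combination_def skew_one fun_eq_iff)

lemma group_element_mult: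
  assumes "a \<in> H" "b \<in> H"
  shows "group_element a \<otimes>\<^bsub>A\<^esub> group_element b = group_element (a * b)"
proof -
  have "(\<Sum>(g, h)\<in>{p \<in> H \<times> H. fst p * snd p = k}. ext_mult (group_element a g) (ext_action m g (group_element b h)) I)
      = group_element (a * b) k I" if k: "k \<in> H" for k I
  proof -
    have "ext_mult (group_element a g) (ext_action m g (group_element b h)) I = (if (g, h) = (a, b) then ext_one I else 0)"
      if "g \<in> H" "h \<in> H" for g h
      using that ext_mult_one_left[OF ext_one_closed]
      by (simp add: group_element_def group_combination_def ext_mult_scale_left ext_mult_scale_right ext_action_scale
          ext_action_one_elt)
    then have "(\<Sum>(g, h)\<in>{p \<in> H \<times> H. fst p * snd p = k}. ext_mult (group_element a g) (ext_action m g (group_element b h)) I)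
      = (\<Sum>p\<in>{p \<in> H \<times> H. fst p * snd p = k}. if p = (a, b) then ext_one I else 0)"
      by (intro sum.cong) (auto split: if_splits)
    also have "\<dots> = (if a * b = k then ext_one I else 0)"
      using assms finite by (subst sum.delta) auto
    finally show ?thesis using k by (simp add: group_element_def group_combination_def)
  qed
  then show ?thesis
    by (auto simp: skew_mult fun_eq_iff) (simp add: group_element_def group_combination_def)
qed

lemma act_group_combination:
  assumes P: "alg_module A P"
  shows "act P (group_combination c) = mat_sum (deg P) (deg P) H (\<lambda>h. c h \<cdot>\<^sub>m act P (group_element h))"
proof -
  \<comment> \<open>The support \<open>F\<close> is made variable so that additivity, available for
    two summands, can be iterated.\<close>
  have "act P (group_combination (\<lambda>k. if k \<in> F then c k else 0)) =
      mat_sum (deg P) (deg P) F (\<lambda>h. c h \<cdot>\<^sub>m act P (group_element h))" if "F \<subseteq> H" for F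
    using finite_subset[OF that finite] that
  proof (induction F rule: finite_induct)
    case empty
    \<comment> \<open>Zero is written as \<open>0\<close> times the unit, whose image is known from
      the module laws.\<close>
    have "group_combination (\<lambda>k. if k \<in> {} then c k else 0) = 0 \<odot>\<^bsub>A\<^esub> \<one>\<^bsub>A\<^esub>"
      by (auto simp: group_combination_def skew_smult)
    then have "act P (group_combination (\<lambda>k. if k \<in> {} then c k else 0)) = 0 \<cdot>\<^sub>m 1\<^sub>m (deg P)"
      by (simp only: alg_module_act[OF P] skew_one_closed)
    then show ?case by (auto simp: mat_sum_def intro!: eq_matI)
  next
    case (insert h F)
    have "group_combination (\<lambda>k. if k \<in> insert h F then c k else 0) =
        (c h \<odot>\<^bsub>A\<^esub> group_element h) \<oplus>\<^bsub>A\<^esub> group_combination (\<lambda>k. if k \<in> F then c k else 0)"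
      using insert by (auto simp: group_combination_def group_element_def skew_smult skew_add fun_eq_iff)
    moreover have "c h \<odot>\<^bsub>A\<^esub> group_element h \<in> carrier A"
      by (simp add: skew_smult_closed)
    ultimately have "act P (group_combination (\<lambda>k. if k \<in> insert h F then c k else 0)) =
        c h \<cdot>\<^sub>m act P (group_element h) + mat_sum (deg P) (deg P) F (\<lambda>h. c h \<cdot>\<^sub>m act P (group_element h))"
      using insert by (simp add: alg_module_act[OF P])
    moreover have "act P (group_element h) \<in> carrier_mat (deg P) (deg P)"
      by (simp add: alg_module_act[OF P])
    ultimately show ?case using insert by (auto simp: mat_sum_def intro!: eq_matI)
  qed
  from this[of H] have "act P (group_combination (\<lambda>k. if k \<in> H then c k else 0)) =
      mat_sum (deg P) (deg P) H (\<lambda>h. c h \<cdot>\<^sub>m act P (group_element h))" by simp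
  moreover have "group_combination (\<lambda>k. if k \<in> H then c k else 0) = group_combination c"
    by (auto simp: group_combination_def)
  ultimately show ?thesis by simp
qed

text \<open>The top degree of the exterior algebra is one-dimensional, annihilated by positive degree, and
  \<open>g\<close> acts on it by \<open>det g\<close>.\<close>

lemma mult_top_element:
  assumes x: "x \<in> carrier A"
  shows "x \<otimes>\<^bsub>A\<^esub> top_element = top_element \<otimes>\<^bsub>A\<^esub> group_combination (\<lambda>k. det k * x k {})"
proof -
  let ?t = "ext_basis {..<m}"
  have "(\<Sum>(g, h)\<in>{p \<in> H \<times> H. fst p * snd p = k}. ext_mult (x g) (ext_action m g (top_element h)) I)
      = det k * x k {} * ?t I" if k: "k \<in> H" for k I
  proof -
    \<comment> \<open>Multiplied with the top element, only the degree zero part of a coefficient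
      survives.\<close>
    have xk: "ext_mult (x k) ?t I = x k {} * ?t I"
    proof (cases "finite I \<and> I \<subseteq> {..<m}")
      case True
      moreover have "ext_sign {} {..<m} = 1" by (rule ext_sign_less) auto
      ultimately show ?thesis by (auto simp: ext_mult_basis_right ext_basis_def)
    next
      case False
      then have "\<not> I \<subseteq> {..<m}" using finite_subset by blast
      moreover have "ext_mult (x k) ?t \<in> ext_carrier m"
        using skew_carrierD[OF x k] ext_basis_closed by (intro ext_mult_closed) auto
      ultimately show ?thesis using ext_carrierD by (auto simp: ext_basis_def)
    qed
    have "ext_mult (x g) (ext_action m g (top_element h)) I =
        (if h = 1\<^sub>m m then det g * ext_mult (x g) ?t I else 0)" if "g \<in> H" "h \<in> H" for g h
      using that by (simp add: top_element_def ext_action_top ext_mult_scale_right)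
    then have "(\<Sum>(g, h)\<in>{p \<in> H \<times> H. fst p * snd p = k}. ext_mult (x g) (ext_action m g (top_element h)) I)
      = (\<Sum>p\<in>{p \<in> H \<times> H. fst p * snd p = k}. if p = (k, 1\<^sub>m m) then det k * ext_mult (x k) ?t I else 0)"
      by (intro sum.cong refl) (auto simp: right_mult_one_mat[OF mat] split: if_splits)
    also have "\<dots> = det k * ext_mult (x k) ?t I"
      using k finite by (subst sum.delta) (auto simp: right_mult_one_mat[OF mat])
    finally show ?thesis by (simp add: xk)
  qed
  moreover have "(\<Sum>(g, h)\<in>{p \<in> H \<times> H. fst p * snd p = k}.
        ext_mult (top_element g) (ext_action m g (group_combination (\<lambda>k. det k * x k {}) h)) I)
      = det k * x k {} * ?t I" if k: "k \<in> H" for k I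
  proof -
    have "ext_mult (top_element g) (ext_action m g (group_combination (\<lambda>k. det k * x k {}) h)) I =
        (if g = 1\<^sub>m m then det h * x h {} * ?t I else 0)" if "g \<in> H" "h \<in> H" for g h
      using that ext_mult_one_right[OF ext_basis_closed[OF order_refl]]
      by (simp add: top_element_def group_combination_def ext[OF ext_action_scale] ext_action_one_elt ext_mult_scale_right)
    then have "(\<Sum>(g, h)\<in>{p \<in> H \<times> H. fst p * snd p = k}.
        ext_mult (top_element g) (ext_action m g (group_combination (\<lambda>k. det k * x k {}) h)) I)
      = (\<Sum>p\<in>{p \<in> H \<times> H. fst p * snd p = k}. if p = (1\<^sub>m m, k) then det k * x k {} * ?t I else 0)"
      by (intro sum.cong refl) (auto simp: left_mult_one_mat[OF mat] split: if_splits)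
    also have "\<dots> = det k * x k {} * ?t I"
      using k finite by (subst sum.delta) (auto simp: left_mult_one_mat[OF mat])
    finally show ?thesis .
  qed
  ultimately show ?thesis
    using x by (auto simp: skew_mult fun_eq_iff)
qed

section \<open>The simple modules and their maps from and to the induced modules\<close>

lemma inflate_deg [simp]: "deg (inflate H M) = deg M"
  by (simp add: inflate_def)

lemma inflate_index_mat:
  "act (inflate H M) x = index_mat (deg M) (deg M) id id (\<lambda>r c. \<Sum>g\<in>H. x g {} * act M g $$ (r, c))"
  by (simp add: inflate_def index_mat_def)

lemma inflate_group_element:
  assumes "g \<in> H" "act M g \<in> carrier_mat (deg M) (deg M)"
  shows "act (inflate H M) (group_element g) = act M g"
proof -
  have "(\<Sum>k\<in>H. group_element g k {} * act M k $$ (r, c)) = act M g $$ (r, c)" for r c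
  proof -
    have "(\<Sum>k\<in>H. group_element g k {} * act M k $$ (r, c)) = (\<Sum>k\<in>H. if k = g then act M g $$ (r, c) else 0)"
      by (intro sum.cong) (auto simp: group_element_def group_combination_def ext_one_def)
    then show ?thesis using assms finite by simp
  qed
  then show ?thesis using assms by (auto simp: inflate_def intro!: eq_matI)
qed

lemma inflate_rep_on: "rep_on (carrier A) (inflate H M)"
  by (simp add: rep_on_def inflate_def)

text \<open>Group elements act on the inflation as they do on \<open>M\<close>, so every submodule
  of it is already a subrepresentation of \<open>M\<close>.\<close>

lemma inflate_simple:
  assumes "rep_on H M" "simple_rep H M"
  shows "simple_rep (carrier A) (inflate H M)"
proof -
  have "subrep H M U" if U: "subrep (carrier A) (inflate H M) U" for U
    unfolding subrep_def
  proof (intro conjI ballI)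
    show "VectorSpace.subspace class_ring U (module_vec TYPE(complex) (deg M))"
      using U by (simp add: subrep_def)
    fix g u assume g: "g \<in> H" and u: "u \<in> U"
    have "act (inflate H M) (group_element g) *\<^sub>v u \<in> U"
      using U u by (simp add: subrep_def)
    then show "act M g *\<^sub>v u \<in> U"
      using assms(1) g by (simp add: inflate_group_element rep_on_def)
  qed
  then show ?thesis using assms(2) by (simp add: simple_rep_def)
qed

text \<open>The augmentation of the induced module: the quotient map that discards all terms of
  positive exterior degree.\<close>

definition degree_zero_projection :: "complex mat rep \<Rightarrow> complex mat" where
  "degree_zero_projection M = index_mat (deg M) (2 ^ m * deg M) id (free_index m (deg M))
    (\<lambda>r (J, c). if J = {} \<and> r = c then 1 else 0)"

definition top_inclusion :: "complex mat rep \<Rightarrow> complex mat" where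
  "top_inclusion M = index_mat (2 ^ m * deg M) (deg M) (free_index m (deg M)) id
    (\<lambda>p r. case p of (J, c) \<Rightarrow> if J = {..<m} \<and> r = c then 1 else 0)"

text \<open>A linear left inverse of \<open>top_inclusion\<close>, used only to witness
  injectivity.\<close>

definition top_projection :: "complex mat rep \<Rightarrow> complex mat" where
  "top_projection M = index_mat (deg M) (2 ^ m * deg M) id (free_index m (deg M))
    (\<lambda>r (J, c). if J = {..<m} \<and> r = c then 1 else 0)"

lemma sum_pairs_delta:
  fixes f :: "nat set \<Rightarrow> nat \<Rightarrow> complex"
  assumes "J \<in> Pow {..<m}" "c < d"
  shows "(\<Sum>p\<in>Pow {..<m} \<times> {..<d}. (case p of (I, s) \<Rightarrow> if I = J \<and> c = s then f I s else 0)) = f J c"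
proof -
  have "(\<Sum>p\<in>Pow {..<m} \<times> {..<d}. (case p of (I, s) \<Rightarrow> if I = J \<and> c = s then f I s else 0)) =
      (\<Sum>p\<in>Pow {..<m} \<times> {..<d}. if p = (J, c) then f J c else 0)"
    by (intro sum.cong) (auto split: if_splits)
  then show ?thesis using assms by simp
qed

lemma bij_id: "bij_betw id {..<d::nat} {..<d}" by simp

text \<open>The degree zero part of a product is the product of the degree zero parts, and the
  action of \<open>g\<close> on the exterior algebra preserves it by
  \<open>ext_action_degree_zero\<close>.\<close>

lemma degree_zero_projection_intertwiner:
  assumes M: "group_rep (GL_sub m H) M"
  shows "degree_zero_projection M \<in> intertwiners (carrier A) (induced_module m H M) (inflate H M)"
  unfolding intertwiners_def
proof (intro CollectI conjI ballI)
  let ?N = "2 ^ m * deg M" and ?d = "deg M" and ?e = "free_index m (deg M)"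
  note bij = free_index[of m "deg M"]
  show "degree_zero_projection M \<in> carrier_mat (deg (inflate H M)) (deg (induced_module m H M))"
    by (simp add: degree_zero_projection_def induced_module_def)
  fix x assume x: "x \<in> carrier A"
  have "(\<Sum>p\<in>Pow {..<m} \<times> {..<?d}. (case p of (I, s) \<Rightarrow> if I = {} \<and> r = s then 1 else 0) * induced_kernel m H M x p (J, c)) =
      (\<Sum>s<?d. (\<Sum>g\<in>H. x g {} * act M g $$ (r, s)) * (if J = {} \<and> s = c then 1 else 0))"
    if r: "r < ?d" and J: "J \<subseteq> {..<m}" and c: "c < ?d" for r J c
  proof -
    have "(\<Sum>p\<in>Pow {..<m} \<times> {..<?d}. (case p of (I, s) \<Rightarrow> if I = {} \<and> r = s then 1 else 0) * induced_kernel m H M x p (J, c)) =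
        (\<Sum>p\<in>Pow {..<m} \<times> {..<?d}. (case p of (I, s) \<Rightarrow> if I = {} \<and> r = s then induced_kernel m H M x (I, s) (J, c) else 0))"
      by (intro sum.cong) auto
    also have "\<dots> = induced_kernel m H M x ({}, r) (J, c)"
      using r by (subst sum_pairs_delta) auto
    also have "\<dots> = (\<Sum>g\<in>H. x g {} * ext_basis J {} * act M g $$ (r, c))"
    proof -
      have "ext_mult (x g) (ext_action m g (ext_basis J)) {} = x g {} * ext_basis J {}" if "g \<in> H" for g
        using that by (simp add: ext_mult_def ext_action_degree_zero ext_sign_def)
      then show ?thesis by (simp add: induced_kernel_def)
    qed
    also have "\<dots> = (\<Sum>s<?d. if s = c then (\<Sum>g\<in>H. x g {} * act M g $$ (r, c)) * ext_basis J {} else 0)"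
      using c by (simp add: sum_distrib_left mult_ac)
    also have "\<dots> = (\<Sum>s<?d. (\<Sum>g\<in>H. x g {} * act M g $$ (r, s)) * (if J = {} \<and> s = c then 1 else 0))"
      by (intro sum.cong) (auto simp: ext_basis_def)
    finally show ?thesis .
  qed
  then show "degree_zero_projection M * act (induced_module m H M) x =
      act (inflate H M) x * degree_zero_projection M"
    unfolding degree_zero_projection_def induced_module_def inflate_index_mat
    by (auto simp: index_mat_mult[OF bij] index_mat_mult[OF bij_id] intro!: index_mat_cong[OF bij_id bij])
qed

lemma degree_zero_projection_right_inverse:
  "\<exists>R\<in>carrier_mat (2 ^ m * deg M) (deg M). degree_zero_projection M * R = 1\<^sub>m (deg M)"
proof
  let ?d = "deg M"
  note bij = free_index[of m "deg M"]
  let ?R = "index_mat (2 ^ m * deg M) (deg M) (free_index m (deg M)) id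
    (\<lambda>p r. case p of (J, c) \<Rightarrow> if J = {} \<and> r = c then 1 else 0)"
  show "?R \<in> carrier_mat (2 ^ m * ?d) ?d" by simp
  have "(\<Sum>p\<in>Pow {..<m} \<times> {..<?d}. (case p of (J, c) \<Rightarrow> if J = {} \<and> r = c then 1 else 0) *
      (case p of (J, c) \<Rightarrow> if J = {} \<and> s = c then 1 else 0)) = (if r = s then 1 else (0::complex))"
    if "r < ?d" for r s
  proof -
    have "(\<Sum>p\<in>Pow {..<m} \<times> {..<?d}. (case p of (J, c) \<Rightarrow> if J = {} \<and> r = c then 1 else 0) *
      (case p of (J, c) \<Rightarrow> if J = {} \<and> s = c then 1 else 0)) =
      (\<Sum>p\<in>Pow {..<m} \<times> {..<?d}. (case p of (J, c) \<Rightarrow> if J = {} \<and> r = c then (if s = c then 1 else 0) else (0::complex)))"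
      by (intro sum.cong) auto
    also have "\<dots> = (if s = r then 1 else 0)" using that by (subst sum_pairs_delta) auto
    finally show ?thesis by auto
  qed
  then show "degree_zero_projection M * ?R = 1\<^sub>m ?d"
    unfolding degree_zero_projection_def index_mat_mult[OF bij]
    by (intro index_mat_cong_kernel[OF bij_id bij_id index_mat_one[OF bij_id]]) auto
qed

lemma degree_zero_projection_surjective: "surjective_mat (degree_zero_projection M)"
proof -
  obtain R where R: "R \<in> carrier_mat (2 ^ m * deg M) (deg M)" "degree_zero_projection M * R = 1\<^sub>m (deg M)"
    using degree_zero_projection_right_inverse by blast
  show ?thesis by (rule surjective_matI[OF _ R]) (simp add: degree_zero_projection_def)
qed

text \<open>A linear right inverse \<open>R\<close> of \<open>T\<close> gives
  \<open>act N x = T * act P x * R\<close>. The module laws of \<open>P\<close> then pass to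
  \<open>N\<close>, which spares a direct verification for inflated representations.\<close>

lemma alg_module_quotient:
  assumes P: "alg_module A P" and T: "T \<in> intertwiners (carrier A) P N" and N: "rep_on (carrier A) N"
    and R: "R \<in> carrier_mat (deg P) (deg N)" "T * R = 1\<^sub>m (deg N)"
    and closed: "\<And>x y. x \<in> carrier A \<Longrightarrow> y \<in> carrier A \<Longrightarrow> x \<otimes>\<^bsub>A\<^esub> y \<in> carrier A"
      "\<And>x y. x \<in> carrier A \<Longrightarrow> y \<in> carrier A \<Longrightarrow> x \<oplus>\<^bsub>A\<^esub> y \<in> carrier A"
      "\<And>c x. x \<in> carrier A \<Longrightarrow> c \<odot>\<^bsub>A\<^esub> x \<in> carrier A" "\<one>\<^bsub>A\<^esub> \<in> carrier A"
  shows "alg_module A N"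
proof -
  let ?n = "deg N" and ?p = "deg P"
  note ac = alg_module_act[OF P] and Tc = intertwinersD(1)[OF T]
  have Nc: "act N x \<in> carrier_mat ?n ?n" if "x \<in> carrier A" for x
    using N that by (simp add: rep_on_def)
  have eq: "act N x = T * act P x * R" if "x \<in> carrier A" for x
    using intertwinersD(2)[OF T that] assoc_mult_mat[OF Nc[OF that] Tc R(1)]
      right_mult_one_mat[OF Nc[OF that]] by (simp add: R(2))
  have "act N (x \<otimes>\<^bsub>A\<^esub> y) = act N x * act N y" if x: "x \<in> carrier A" and y: "y \<in> carrier A" for x y
  proof -
    have "T * act P (x \<otimes>\<^bsub>A\<^esub> y) = act N x * T * act P y"
      using assoc_mult_mat[OF Tc ac(1)[OF x] ac(1)[OF y]] intertwinersD(2)[OF T x] by (simp add: ac(2) x y)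
    also have "\<dots> = act N x * act N y * T"
      using assoc_mult_mat[OF Nc[OF x] Tc ac(1)[OF y]] assoc_mult_mat[OF Nc[OF x] Nc[OF y] Tc]
        intertwinersD(2)[OF T y] by simp
    finally have "act N (x \<otimes>\<^bsub>A\<^esub> y) = act N x * act N y * T * R"
      using eq[OF closed(1)[OF x y]] by simp
    also have "\<dots> = act N x * act N y"
      using assoc_mult_mat[OF mult_carrier_mat[OF Nc[OF x] Nc[OF y]] Tc R(1)]
        right_mult_one_mat[OF mult_carrier_mat[OF Nc[OF x] Nc[OF y]]] by (simp add: R(2))
    finally show ?thesis .
  qed
  moreover have "act N (x \<oplus>\<^bsub>A\<^esub> y) = act N x + act N y" if x: "x \<in> carrier A" and y: "y \<in> carrier A" for x y
    unfolding eq[OF x] eq[OF y] eq[OF closed(2)[OF x y]] ac(3)[OF x y]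
    using mult_add_distrib_mat[OF Tc ac(1)[OF x] ac(1)[OF y]]
      add_mult_distrib_mat[OF mult_carrier_mat[OF Tc ac(1)[OF x]] mult_carrier_mat[OF Tc ac(1)[OF y]] R(1)]
    by simp
  moreover have "act N (c \<odot>\<^bsub>A\<^esub> x) = c \<cdot>\<^sub>m act N x" if x: "x \<in> carrier A" for c x
    unfolding eq[OF x] eq[OF closed(3)[OF x]] ac(5)[OF x]
    using mult_smult_distrib[OF Tc ac(1)[OF x]] mult_smult_assoc_mat[OF mult_carrier_mat[OF Tc ac(1)[OF x]] R(1)]
    by simp
  moreover have "act N \<one>\<^bsub>A\<^esub> = 1\<^sub>m ?n"
    using eq[OF closed(4)] right_mult_one_mat[OF Tc] by (simp add: ac(4) R(2))
  ultimately show ?thesis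
    using Nc by (simp add: alg_module_def Ring.ring_hom_def ring_mat_simps)
qed

text \<open>The lifting property in \<open>projective_module\<close> quantifies over modules only,
  so the target of \<open>\<pi>\<close> has to be recognized as one. It is a quotient of the induced
  module.\<close>

lemma inflate_alg_module:
  assumes M: "group_rep (GL_sub m H) M"
  shows "alg_module A (inflate H M)"
proof -
  obtain R where "R \<in> carrier_mat (2 ^ m * deg M) (deg M)" "degree_zero_projection M * R = 1\<^sub>m (deg M)"
    using degree_zero_projection_right_inverse by blast
  then show ?thesis
    by (intro alg_module_quotient[OF induced_module[OF M] degree_zero_projection_intertwiner[OF M]
          inflate_rep_on, where R = R])
      (auto simp: induced_module_def skew_mult_closed skew_add_closed skew_smult_closed skew_one_closed)
qed

lemma top_projection_inclusion: "top_projection M * top_inclusion M = 1\<^sub>m (deg M)"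
proof -
  let ?d = "deg M"
  note bij = free_index[of m "deg M"]
  have "(\<Sum>p\<in>Pow {..<m} \<times> {..<?d}. (case p of (J, c) \<Rightarrow> if J = {..<m} \<and> r = c then 1 else 0) *
      (case p of (J, c) \<Rightarrow> if J = {..<m} \<and> s = c then 1 else 0)) = (if r = s then 1 else (0::complex))"
    if "r < ?d" for r s
  proof -
    have "(\<Sum>p\<in>Pow {..<m} \<times> {..<?d}. (case p of (J, c) \<Rightarrow> if J = {..<m} \<and> r = c then 1 else 0) *
      (case p of (J, c) \<Rightarrow> if J = {..<m} \<and> s = c then 1 else 0)) =
      (\<Sum>p\<in>Pow {..<m} \<times> {..<?d}. (case p of (J, c) \<Rightarrow> if J = {..<m} \<and> r = c then (if s = c then 1 else 0) else (0::complex)))"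
      by (intro sum.cong) auto
    also have "\<dots> = (if s = r then 1 else 0)" using that by (subst sum_pairs_delta) auto
    finally show ?thesis by auto
  qed
  then show ?thesis
    unfolding top_projection_def top_inclusion_def index_mat_mult[OF bij]
    by (intro index_mat_cong_kernel[OF bij_id bij_id index_mat_one[OF bij_id]]) auto
qed

text \<open>The top element annihilates positive degrees and carries degree zero to the top degree.
  In this factored form it can be composed with a lift \<open>k\<close> of \<open>\<pi>\<close>,
  since \<open>degree_zero_projection M * k\<close> is \<open>\<pi>\<close>.\<close>

lemma induced_top_element:
  assumes M: "group_rep (GL_sub m H) M"
  shows "act (induced_module m H M) top_element = top_inclusion M * degree_zero_projection M"
proof -
  let ?d = "deg M"
  note bij = free_index[of m "deg M"]
  have "induced_kernel m H M top_element (I, r) (J, c) =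
      (\<Sum>s<?d. (if I = {..<m} \<and> s = r then 1 else 0) * (if J = {} \<and> s = c then 1 else 0))"
    if I: "I \<subseteq> {..<m}" and r: "r < ?d" and J: "J \<subseteq> {..<m}" and c: "c < ?d" for I r J c
  proof -
    have fin: "finite I" using I finite_subset by blast
    have "induced_kernel m H M top_element (I, r) (J, c) =
        (\<Sum>g\<in>H. if g = 1\<^sub>m m then ext_mult (ext_basis {..<m}) (ext_basis J) I * (if r = c then 1 else 0) else 0)"
      using r c by (auto simp: induced_kernel_def top_element_def ext_action_id[OF ext_basis_closed[OF J]] rep_one[OF M] intro!: sum.cong)
    also have "\<dots> = ext_mult (ext_basis {..<m}) (ext_basis J) I * (if r = c then 1 else 0)"
      using finite by simp
    also have "ext_mult (ext_basis {..<m}) (ext_basis J) I = (if I = {..<m} \<and> J = {} then 1 else 0)"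
    proof -
      have "J = {} \<and> I = {..<m}" if "J \<subseteq> I" "I - J = {..<m}" using that I by blast
      moreover have "ext_sign {..<m} {} = 1" by (rule ext_sign_less) auto
      ultimately show ?thesis using fin by (auto simp: ext_mult_basis_right ext_basis_def)
    qed
    also have "(if I = {..<m} \<and> J = {} then 1 else 0) * (if r = c then 1 else 0) =
        (\<Sum>s<?d. if s = r then (if I = {..<m} \<and> J = {} \<and> r = c then 1 else (0::complex)) else 0)"
      using r by simp
    also have "\<dots> = (\<Sum>s<?d. (if I = {..<m} \<and> s = r then 1 else 0) * (if J = {} \<and> s = c then 1 else 0))"
      by (intro sum.cong) auto
    finally show ?thesis .
  qed
  then show ?thesis
    unfolding degree_zero_projection_def top_inclusion_def
    by (auto simp: induced_module_def index_mat_mult[OF bij_id] intro!: index_mat_cong[OF bij bij])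
qed

text \<open>The group elements are units of the algebra, which puts their matrices into
  \<open>GL\<close>. Averaging over \<open>H\<close> thereby becomes available on
  \<open>P\<close>.\<close>

lemma restricted_group_rep:
  assumes P: "alg_module A P"
  shows "group_rep (GL_sub m H) \<lparr>deg = deg P, act = (\<lambda>g. act P (group_element g))\<rparr>"
proof -
  note ac = alg_module_act[OF P]
  have "act P (group_element g) * act P (group_element (ginv g)) = 1\<^sub>m (deg P)"
    "act P (group_element (ginv g)) * act P (group_element g) = 1\<^sub>m (deg P)" if "g \<in> H" for g
    using that by (simp_all add: ac(2)[symmetric] group_element_mult group_element_one ac(4))
  then have "act P (group_element g) \<in> carrier (GL (deg P))" if "g \<in> H" for g
    using that ac(1)[OF group_element_closed]
    by (auto simp: GL_def units_of_def Units_def ring_mat_simps)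
  then show ?thesis
    by (auto simp: group_rep_def hom_def group_element_mult[symmetric] ac(2))
qed

text \<open>Maschke's argument: an arbitrary linear right inverse of \<open>\<pi>\<close> is
  averaged over \<open>H\<close>. Compatibility is asserted for group elements only, not for the
  whole algebra.\<close>

lemma equivariant_section:
  assumes M: "group_rep (GL_sub m H) M" and P: "alg_module A P"
    and \<pi>: "\<pi> \<in> intertwiners (carrier A) P (inflate H M)" and surj: "surjective_mat \<pi>"
  shows "\<exists>s\<in>carrier_mat (deg P) (deg M). \<pi> * s = 1\<^sub>m (deg M) \<and>
    (\<forall>g\<in>H. act P (group_element g) * s = s * act M g)"
proof -
  let ?P = "\<lparr>deg = deg P, act = (\<lambda>g. act P (group_element g))\<rparr>"
  let ?d = "deg M" and ?n = "deg P"
  have c: "\<pi> \<in> carrier_mat ?d ?n" using intertwinersD(1)[OF \<pi>] by simp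
  have "\<exists>v\<in>carrier_vec ?n. \<pi> *\<^sub>v v = col (1\<^sub>m ?d) j" if "j < ?d" for j
  proof -
    have "col (1\<^sub>m ?d) j \<in> (*\<^sub>v) \<pi> ` carrier_vec ?n"
      using surj c that by (simp add: surjective_mat_def)
    then show ?thesis by (metis (no_types, lifting) imageE)
  qed
  then obtain R where R: "R \<in> carrier_mat ?n ?d" "\<pi> * R = 1\<^sub>m ?d"
    using mat_solve[OF c one_carrier_mat] by metis
  define s where "s = (1 / of_nat (card H)) \<cdot>\<^sub>m average M ?P R"
  have av: "average M ?P R \<in> intertwiners H M ?P"
    using R(1) by (intro average_intertwiner[OF M restricted_group_rep[OF P]]) simp
  have avc: "average M ?P R \<in> carrier_mat ?n ?d" using intertwinersD(1)[OF av] by simp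
  have Pc: "act P (group_element g) \<in> carrier_mat ?n ?n" for g
    using alg_module_act(1)[OF P] by simp
  \<comment> \<open>Each summand becomes a conjugate of \<open>\<pi> * R\<close>, hence the
    identity, so the average is sent to \<open>card H\<close> times the identity.\<close>
  have "\<pi> * average M ?P R = mat_sum ?d ?d H (\<lambda>h. \<pi> * (act P (group_element h) * R * act M (ginv h)))"
  proof -
    have "average M ?P R = mat_sum ?n ?d H (\<lambda>h. act P (group_element h) * R * act M (ginv h))"
      by (simp add: average_def)
    moreover have "act P (group_element h) * R * act M (ginv h) \<in> carrier_mat ?n ?d" if "h \<in> H" for h
      using Pc[of h] R(1) rep_mat[OF M ginv(1)[OF that]] by simp
    ultimately show ?thesis by (simp only:) (rule mat_sum_mult_left[OF c])
  qed
  also have "\<dots> = mat_sum ?d ?d H (\<lambda>h. 1\<^sub>m ?d)"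
  proof (rule mat_sum_cong)
    fix h assume h: "h \<in> H"
    note mc = rep_mat[OF M h] rep_mat[OF M ginv(1)[OF h]]
    have "\<pi> * (act P (group_element h) * R * act M (ginv h)) = (\<pi> * act P (group_element h)) * R * act M (ginv h)"
      using c Pc[of h] R(1) mc
      by (simp add: assoc_mult_mat[of _ ?d ?n _ ?n _ ?d] assoc_mult_mat[of _ ?n ?n _ ?d _ ?d]
          assoc_mult_mat[of _ ?d ?n _ ?d _ ?d])
    also have "\<pi> * act P (group_element h) = act M h * \<pi>"
      using intertwinersD(2)[OF \<pi> group_element_closed] inflate_group_element[OF h mc(1)] by simp
    also have "act M h * \<pi> * R * act M (ginv h) = act M h * (\<pi> * R) * act M (ginv h)"
      using c R(1) mc by (simp add: assoc_mult_mat[of _ ?d ?d _ ?n _ ?d])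
    also have "\<dots> = 1\<^sub>m ?d" using mc h by (simp add: R(2) rep_ginv[OF M] right_mult_one_mat[OF mc(1)])
    finally show "\<pi> * (act P (group_element h) * R * act M (ginv h)) = 1\<^sub>m ?d" .
  qed
  finally have "\<pi> * average M ?P R = mat_sum ?d ?d H (\<lambda>h. 1\<^sub>m ?d)" .
  moreover have "card H \<noteq> 0" using finite one by (metis card_0_eq empty_iff)
  ultimately have "\<pi> * s = 1\<^sub>m ?d"
    unfolding s_def using mult_smult_distrib[OF c avc]
    by (auto simp: mat_sum_def intro!: eq_matI)
  moreover have "act P (group_element g) * s = s * act M g" if g: "g \<in> H" for g
    unfolding s_def using intertwinersD(2)[OF av g] mult_smult_distrib[OF Pc avc]
      mult_smult_assoc_mat[OF avc rep_mat[OF M g]] by simp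
  moreover have "s \<in> carrier_mat ?n ?d" using avc by (simp add: s_def)
  ultimately show ?thesis by auto
qed

text \<open>The tensor product with the determinant character, realized on the space of
  \<open>M\<close> itself without a Kronecker product.\<close>

definition det_twist :: "complex mat rep \<Rightarrow> complex mat rep" where
  "det_twist M = \<lparr>deg = deg M, act = (\<lambda>g. det g \<cdot>\<^sub>m act M g)\<rparr>"

lemma det_nonzero: "g \<in> H \<Longrightarrow> det g \<noteq> 0"
  using det_mult[of g m "ginv g"] by (auto simp: det_one)

lemma det_twist_rep_on: "rep_on H M \<Longrightarrow> rep_on H (det_twist M)"
  by (simp add: rep_on_def det_twist_def)

text \<open>Rescaling each matrix by a nonzero number does not change the invariant
  subspaces.\<close>

lemma det_twist_simple:
  assumes M: "rep_on H M" and simple: "simple_rep H M"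
  shows "simple_rep H (det_twist M)"
proof -
  have "subrep H M U" if U: "subrep H (det_twist M) U" for U
    unfolding subrep_def
  proof (intro conjI ballI)
    show "VectorSpace.subspace class_ring U (module_vec TYPE(complex) (deg M))"
      using U by (simp add: subrep_def det_twist_def)
    then have sub: "U \<subseteq> carrier_vec (deg M)" and smult: "\<And>c u. u \<in> U \<Longrightarrow> c \<cdot>\<^sub>v u \<in> U"
      by (auto simp: subspace_iff)
    fix g u assume g: "g \<in> H" and u: "u \<in> U"
    have gc: "act M g \<in> carrier_mat (deg M) (deg M)" using M g by (simp add: rep_on_def)
    have "inverse (det g) \<cdot>\<^sub>v ((det g \<cdot>\<^sub>m act M g) *\<^sub>v u) \<in> U"
      using U g u by (intro smult) (simp add: subrep_def det_twist_def)
    moreover have "(det g \<cdot>\<^sub>m act M g) *\<^sub>v u = det g \<cdot>\<^sub>v (act M g *\<^sub>v u)"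
      using gc sub u by (intro eq_vecI) (auto simp: scalar_prod_def sum_distrib_left mult_ac)
    ultimately show "act M g *\<^sub>v u \<in> U"
      using det_nonzero[OF g] by (simp add: smult_smult_assoc)
  qed
  then show ?thesis using simple by (simp add: simple_rep_def det_twist_def)
qed

text \<open>Lifting \<open>\<pi>\<close> to a map \<open>k\<close> into the induced module
  shows that the top exterior power acts injectively on an \<open>H\<close>-complement of the kernel of \<open>\<pi>\<close>.\<close>

lemma det_twist_in_projective:
  assumes M: "group_rep (GL_sub m H) M" and proj: "projective_module A P"
    and \<pi>: "\<pi> \<in> intertwiners (carrier A) P (inflate H M)" and surj: "surjective_mat \<pi>"
  shows "\<exists>T\<in>intertwiners (carrier A) (inflate H (det_twist M)) P.
    \<exists>L\<in>carrier_mat (deg M) (deg P). L * T = 1\<^sub>m (deg M)"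
proof -
  let ?d = "deg M" and ?n = "deg P" and ?I = "induced_module m H M"
  have P: "alg_module A P" using proj by (simp add: projective_module_def)
  note ac = alg_module_act[OF P]
  have infl: "alg_module A (inflate H M)" by (rule inflate_alg_module[OF M])
  obtain k where k: "k \<in> intertwiners (carrier A) P ?I" "degree_zero_projection M * k = \<pi>"
    using proj infl induced_module[OF M] degree_zero_projection_intertwiner[OF M]
      degree_zero_projection_surjective \<pi> unfolding projective_module_def by meson
  obtain s where s: "s \<in> carrier_mat ?n ?d" "\<pi> * s = 1\<^sub>m ?d"
    "\<And>g. g \<in> H \<Longrightarrow> act P (group_element g) * s = s * act M g"
    using equivariant_section[OF M P \<pi> surj] by metis
  have kc: "k \<in> carrier_mat (2 ^ m * ?d) ?n"
    using intertwinersD(1)[OF k(1)] by (simp add: induced_module_def)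
  have tc: "act P top_element \<in> carrier_mat ?n ?n" by (rule ac(1)) simp
  have inc: "top_inclusion M \<in> carrier_mat (2 ^ m * ?d) ?d" "top_projection M \<in> carrier_mat ?d (2 ^ m * ?d)"
    "degree_zero_projection M \<in> carrier_mat ?d (2 ^ m * ?d)"
    by (simp_all add: top_inclusion_def top_projection_def degree_zero_projection_def)
  define T where "T = act P top_element * s"
  have Tc: "T \<in> carrier_mat ?n ?d" using tc s by (simp add: T_def)
  \<comment> \<open>The vector \<open>s u\<close> lifts \<open>u\<close>, so \<open>k (s u)\<close>
    has degree zero part \<open>u\<close>, and the top element sends it to the copy of
    \<open>u\<close> in top degree. Hence \<open>k * T\<close> is
    \<open>top_inclusion M\<close>.\<close>
  have "k * T = k * act P top_element * s"
    unfolding T_def using assoc_mult_mat[OF kc tc s(1)] by simp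
  also have "\<dots> = top_inclusion M * degree_zero_projection M * k * s"
    using intertwinersD(2)[OF k(1) top_element_closed] by (simp add: induced_top_element[OF M])
  also have "\<dots> = top_inclusion M * (degree_zero_projection M * k) * s"
    using assoc_mult_mat[OF inc(1,3) kc] by simp
  also have "\<dots> = top_inclusion M * (\<pi> * s)"
    unfolding k(2) using intertwinersD(1)[OF \<pi>] by (intro assoc_mult_mat[OF inc(1) _ s(1)]) simp
  also have "\<dots> = top_inclusion M" using right_mult_one_mat[OF inc(1)] by (simp add: s(2))
  finally have "top_projection M * k * T = 1\<^sub>m ?d"
    using assoc_mult_mat[OF inc(2) kc Tc] by (simp add: top_projection_inclusion)
  moreover have "top_projection M * k \<in> carrier_mat ?d ?n" using inc(2) kc by simp
  moreover have "T \<in> intertwiners (carrier A) (inflate H (det_twist M)) P"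
    unfolding intertwiners_def
  proof (intro CollectI conjI ballI)
    show "T \<in> carrier_mat (deg P) (deg (inflate H (det_twist M)))" using Tc by (simp add: det_twist_def)
    fix x assume x: "x \<in> carrier A"
    let ?c = "\<lambda>k. det k * x k {}"
    \<comment> \<open>By \<open>mult_top_element\<close>, \<open>x\<close> times the top element is
      the top element times the combination of group elements with coefficients \<open>?c\<close>.
      Through \<open>s\<close> this combination acts as on \<open>M\<close>, and its factors
      \<open>det k\<close> are those of the twist.\<close>
    have "act P (group_combination ?c) * s = mat_sum ?n ?d H (\<lambda>h. ?c h \<cdot>\<^sub>m act P (group_element h) * s)"
      unfolding act_group_combination[OF P] using s(1) ac(1) by (intro mat_sum_mult_right) auto
    also have "\<dots> = mat_sum ?n ?d H (\<lambda>h. s * (?c h \<cdot>\<^sub>m act M h))"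
    proof (rule mat_sum_cong)
      fix h assume h: "h \<in> H"
      show "?c h \<cdot>\<^sub>m act P (group_element h) * s = s * (?c h \<cdot>\<^sub>m act M h)"
        using mult_smult_assoc_mat[OF ac(1)[OF group_element_closed] s(1)]
          mult_smult_distrib[OF s(1) rep_mat[OF M h]] s(3)[OF h] by simp
    qed
    also have "\<dots> = s * mat_sum ?d ?d H (\<lambda>h. ?c h \<cdot>\<^sub>m act M h)"
      using s(1) rep_mat[OF M] by (intro mat_sum_mult_left[symmetric]) auto
    also have "mat_sum ?d ?d H (\<lambda>h. ?c h \<cdot>\<^sub>m act M h) = act (inflate H (det_twist M)) x"
      using carrier_matD[OF rep_mat[OF M]] by (auto simp: mat_sum_def inflate_def det_twist_def mult_ac intro!: eq_matI sum.cong)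
    finally have eq: "act P (group_combination ?c) * s = s * act (inflate H (det_twist M)) x" .
    have "act P x * T = act P (x \<otimes>\<^bsub>A\<^esub> top_element) * s"
      unfolding T_def using x s tc by (simp add: ac(2) assoc_mult_mat[OF ac(1)[OF x] tc s(1)])
    also have "\<dots> = act P top_element * act P (group_combination ?c) * s"
      by (simp add: mult_top_element[OF x] ac(2))
    also have "\<dots> = act P top_element * (s * act (inflate H (det_twist M)) x)"
      using assoc_mult_mat[OF tc ac(1)[OF group_combination_closed] s(1)] eq by simp
    also have "\<dots> = T * act (inflate H (det_twist M)) x"
    proof -
      have "act (inflate H (det_twist M)) x \<in> carrier_mat ?d ?d" by (simp add: inflate_def det_twist_def)
      then show ?thesis unfolding T_def using assoc_mult_mat[OF tc s(1)] by simp
    qed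
    finally show "T * act (inflate H (det_twist M)) x = act P x * T" by simp
  qed
  ultimately show ?thesis by auto
qed

text \<open>The twisted module embeds as a simple submodule, hence into the socle, which is a copy
  of \<open>N\<close> via \<open>t\<close>. Factoring the embedding through \<open>t\<close> gives a
  nonzero intertwiner of simple representations of \<open>H\<close>, so the two are isomorphic and
  have equal traces.\<close>

lemma socle_projective_cover:
  assumes M: "group_rep (GL_sub m H) M" "simple_rep H M" and N: "group_rep (GL_sub m H) N" "simple_rep H N"
    and cover: "projective_cover A P \<pi> (inflate H M)" and soc: "socle_iso A P (inflate H N)"
    and g: "g \<in> H"
  shows "mat_trace (act N g) = det g * mat_trace (act M g)"
proof -
  let ?D = "det_twist M" and ?d = "deg M"
  have degD: "deg ?D = ?d" by (simp add: det_twist_def)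
  have P: "alg_module A P" using cover by (simp add: projective_cover_def projective_module_def)
  note reps = det_twist_rep_on[OF rep_on[OF M(1)]] rep_on[OF N(1)]
  note simple = det_twist_simple[OF rep_on[OF M(1)] M(2)] N(2)
  have \<pi>: "projective_module A P" "\<pi> \<in> intertwiners (carrier A) P (inflate H M)" "surjective_mat \<pi>"
    using cover by (simp_all add: projective_cover_def)
  obtain T L where T: "T \<in> intertwiners (carrier A) (inflate H ?D) P" and L: "L \<in> carrier_mat ?d (deg P)" "L * T = 1\<^sub>m ?d"
    using det_twist_in_projective[OF M(1) \<pi>] by auto
  have Tc: "T \<in> carrier_mat (deg P) ?d" using intertwinersD(1)[OF T] degD by simp
  have "simple_subrep (carrier A) P ((*\<^sub>v) T ` carrier_vec (deg (inflate H ?D)))"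
    using L degD by (intro simple_subrep_image[OF T inflate_rep_on alg_module_rep_on[OF P]
      inflate_simple[OF reps(1) simple(1)]]) auto
  then have sub: "(*\<^sub>v) T ` carrier_vec ?d \<subseteq> socle (carrier A) P"
    using simple_subrep_socle degD by (metis inflate_deg)
  obtain t where t: "t \<in> intertwiners (carrier A) (inflate H N) P"
    "bij_betw (\<lambda>v. t *\<^sub>v v) (carrier_vec (deg N)) (socle (carrier A) P)"
    using soc by (auto simp: socle_iso_def)
  have tc: "t \<in> carrier_mat (deg P) (deg N)" using intertwinersD(1)[OF t(1)] by simp
  have inj: "inj_on ((*\<^sub>v) t) (carrier_vec (deg N))" using t(2) by (simp add: bij_betw_def)
  have "\<exists>v\<in>carrier_vec (deg N). t *\<^sub>v v = col T j" if "j < ?d" for j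
  proof -
    have "col T j = T *\<^sub>v unit_vec ?d j" using mat_mult_unit_vec[OF Tc that] by simp
    then have "col T j \<in> (*\<^sub>v) t ` carrier_vec (deg N)"
      using sub t(2) by (auto simp: bij_betw_def)
    then show ?thesis by (metis (no_types, lifting) imageE)
  qed
  then obtain C where C: "C \<in> carrier_mat (deg N) ?d" "t * C = T" using mat_solve[OF tc Tc] by metis
  have "C \<in> intertwiners H ?D N"
    unfolding intertwiners_def
  proof (intro CollectI conjI ballI)
    show "C \<in> carrier_mat (deg N) (deg ?D)" using C degD by simp
    fix h assume h: "h \<in> H"
    have Dc: "act ?D h \<in> carrier_mat ?d ?d" and Nc: "act N h \<in> carrier_mat (deg N) (deg N)"
      using reps h by (auto simp: rep_on_def degD)
    have Pc: "act P (group_element h) \<in> carrier_mat (deg P) (deg P)"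
      by (simp add: alg_module_act(1)[OF P])
    have D: "T * act ?D h = act P (group_element h) * T"
      using intertwinersD(2)[OF T group_element_closed[of h]] inflate_group_element[OF h, of ?D] Dc degD by simp
    have N: "t * act N h = act P (group_element h) * t"
      using intertwinersD(2)[OF t(1) group_element_closed[of h]] inflate_group_element[OF h Nc] by simp
    \<comment> \<open>The relation is checked after composition with \<open>t\<close>, which is
      injective.\<close>
    have "t * (C * act ?D h) = T * act ?D h" using assoc_mult_mat[OF tc C(1) Dc] C(2) by simp
    also have "\<dots> = act P (group_element h) * t * C" using assoc_mult_mat[OF Pc tc C(1)] by (simp add: D C(2))
    also have "\<dots> = t * (act N h * C)" using assoc_mult_mat[OF tc Nc C(1)] unfolding N .
    finally show "C * act ?D h = act N h * C"
      by (rule mat_cancel_left[OF tc mult_carrier_mat[OF C(1) Dc] mult_carrier_mat[OF Nc C(1)] inj])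
  qed
  moreover have "C \<noteq> 0\<^sub>m (deg N) (deg ?D)"
  proof
    assume "C = 0\<^sub>m (deg N) (deg ?D)"
    then have "T = 0\<^sub>m (deg P) ?d" using C(2) tc degD by simp
    then have "1\<^sub>m ?d = (0\<^sub>m ?d ?d :: complex mat)" using L by simp
    then have "(1\<^sub>m ?d :: complex mat) $$ (0, 0) = 0\<^sub>m ?d ?d $$ (0, 0)" by simp
    then show False using M(2) by (simp add: simple_rep_def)
  qed
  ultimately obtain R where "C \<in> intertwiners H ?D N" "R \<in> carrier_mat (deg ?D) (deg N)"
      "C * R = 1\<^sub>m (deg N)" "R * C = 1\<^sub>m (deg ?D)"
    using schur_invertible[OF _ reps simple] by blast
  then have "rep_iso H ?D N" by (rule rep_isoI)
  then have "mat_trace (act ?D g) = mat_trace (act N g)"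
    using reps g by (intro rep_iso_trace) (auto simp: rep_on_def)
  moreover have "mat_trace (act ?D g) = det g * mat_trace (act M g)"
    using carrier_matD[OF rep_mat[OF M(1) g]] by (simp add: mat_trace_def det_twist_def sum_distrib_left)
  ultimately show ?thesis by simp
qed

end

section \<open>McKay quivers\<close>

text \<open>For every ordered pair of vertices a bijection of the parallel arrows is chosen. These
  bijections glue because an arrow determines its tail and head.\<close>

lemma quiver_iso_over_verts_if_card_eq:
  assumes Q: "fin_digraph Q" and R: "fin_digraph R" and verts: "verts R = verts Q"
    and card: "\<And>v w. v \<in> verts Q \<Longrightarrow> w \<in> verts Q \<Longrightarrow>
      card {e \<in> arcs Q. tail Q e = v \<and> head Q e = w} = card {e \<in> arcs R. tail R e = v \<and> head R e = w}"
  shows "quiver_iso_over_verts Q R"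
proof -
  interpret Q: fin_digraph Q by (rule Q)
  interpret R: fin_digraph R by (rule R)
  let ?AQ = "\<lambda>v w. {e \<in> arcs Q. tail Q e = v \<and> head Q e = w}"
    and ?AR = "\<lambda>v w. {e \<in> arcs R. tail R e = v \<and> head R e = w}"
  define \<beta> where "\<beta> v w = (SOME b. bij_betw b (?AQ v w) (?AR v w))" for v w
  have \<beta>: "bij_betw (\<beta> v w) (?AQ v w) (?AR v w)" if "v \<in> verts Q" "w \<in> verts Q" for v w
  proof -
    have "\<exists>b. bij_betw b (?AQ v w) (?AR v w)"
      using that by (intro finite_same_card_bij card) simp_all
    then show ?thesis unfolding \<beta>_def by (rule someI_ex)
  qed
  define \<psi> where "\<psi> e = \<beta> (tail Q e) (head Q e) e" for e
  have \<psi>: "\<psi> e \<in> arcs R" "tail R (\<psi> e) = tail Q e" "head R (\<psi> e) = head Q e" if e: "e \<in> arcs Q" for e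
    using bij_betwE[OF \<beta>[OF Q.tail_in_verts[OF e] Q.head_in_verts[OF e]]] e by (auto simp: \<psi>_def)
  have inj: "inj_on \<psi> (arcs Q)"
  proof (rule inj_onI)
    fix e e' assume e: "e \<in> arcs Q" and e': "e' \<in> arcs Q" and eq: "\<psi> e = \<psi> e'"
    have same: "tail Q e' = tail Q e" "head Q e' = head Q e"
      using \<psi>(2,3)[OF e] \<psi>(2,3)[OF e'] eq by simp_all
    have "inj_on (\<beta> (tail Q e) (head Q e)) {d \<in> arcs Q. tail Q d = tail Q e \<and> head Q d = head Q e}"
      using \<beta>[OF Q.tail_in_verts[OF e] Q.head_in_verts[OF e]] by (rule bij_betw_imp_inj_on)
    then show "e = e'" using e e' eq same unfolding \<psi>_def by (auto dest: inj_onD)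
  qed
  have surj: "\<psi> ` arcs Q = arcs R"
  proof
    show "\<psi> ` arcs Q \<subseteq> arcs R" using \<psi>(1) by auto
    show "arcs R \<subseteq> \<psi> ` arcs Q"
    proof
      fix r assume r: "r \<in> arcs R"
      let ?v = "tail R r" and ?w = "head R r"
      have vw: "?v \<in> verts Q" "?w \<in> verts Q"
        using R.tail_in_verts[OF r] R.head_in_verts[OF r] by (simp_all add: verts)
      have "r \<in> \<beta> ?v ?w ` ?AQ ?v ?w"
        unfolding bij_betw_imp_surj_on[OF \<beta>[OF vw]] using r by simp
      then obtain e where e: "r = \<beta> ?v ?w e" "e \<in> ?AQ ?v ?w" by (rule imageE)
      have "\<psi> e = \<beta> ?v ?w e" using e(2) by (simp add: \<psi>_def)
      then have "\<psi> e = r" by (rule trans[OF _ e(1)[symmetric]])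
      moreover have "\<psi> e \<in> \<psi> ` arcs Q" using e(2) by simp
      ultimately show "r \<in> \<psi> ` arcs Q" by simp
    qed
  qed
  \<comment> \<open>\<open>app_iso\<close> copies the tail and head functions of the isomorphism, so
    taking those of \<open>R\<close> yields equality of the records, also outside the arcs.\<close>
  let ?\<phi> = "\<lparr>iso_verts = (\<lambda>v. v), iso_arcs = \<psi>, iso_head = head R, iso_tail = tail R\<rparr>"
  have "pre_digraph.digraph_isomorphism Q ?\<phi>"
    using inj \<psi> Q.wf_digraph_axioms by (simp add: pre_digraph.digraph_isomorphism_def)
  moreover have "R = app_iso ?\<phi> Q"
    by (rule pre_digraph.equality) (simp_all add: verts surj)
  ultimately show ?thesis unfolding quiver_iso_over_verts_def by (intro exI[of _ ?\<phi>]) simp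
qed

lemma fin_digraph_add_arrows:
  assumes "fin_digraph Q" "\<sigma> ` verts Q \<subseteq> verts Q"
  shows "fin_digraph (add_arrows \<sigma> Q)"
proof -
  interpret Q: fin_digraph Q by (rule assms(1))
  show ?thesis using assms(2) by unfold_locales (auto simp: add_arrows_def)
qed

lemma card_add_arrows:
  assumes "fin_digraph Q" "w \<in> verts Q"
  shows "card {e \<in> arcs (add_arrows \<sigma> Q). tail (add_arrows \<sigma> Q) e = v \<and> head (add_arrows \<sigma> Q) e = w} =
    card {e \<in> arcs Q. tail Q e = v \<and> head Q e = w} + (if \<sigma> w = v then 1 else 0)"
proof -
  interpret Q: fin_digraph Q by (rule assms(1))
  have "{e \<in> arcs (add_arrows \<sigma> Q). tail (add_arrows \<sigma> Q) e = v \<and> head (add_arrows \<sigma> Q) e = w} =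
      Inl ` {e \<in> arcs Q. tail Q e = v \<and> head Q e = w} \<union> (if \<sigma> w = v then {Inr w} else {})"
    using assms(2) by (auto simp: add_arrows_def)
  moreover have "card (Inl ` {e \<in> arcs Q. tail Q e = v \<and> head Q e = w} :: ('b + 'a) set) =
      card {e \<in> arcs Q. tail Q e = v \<and> head Q e = w}"
    by (rule card_image) simp
  moreover have "finite (Inl ` {e \<in> arcs Q. tail Q e = v \<and> head Q e = w} :: ('b + 'a) set)"
    by simp
  ultimately show ?thesis by (simp add: card_insert_disjoint image_iff)
qed

section \<open>Character identities of McKay quivers and the embedding of the group\<close>

lemma kronecker_carrier:
  "B \<in> carrier_mat a a \<Longrightarrow> C \<in> carrier_mat b b \<Longrightarrow> kronecker B C \<in> carrier_mat (a * b) (a * b)"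
  by (auto simp: kronecker_def)

text \<open>The trace of the defining isomorphism at vertex \<open>i\<close>: the arrow numbers
  become coefficients in an identity of characters.\<close>

lemma mckay_quiver_character:
  assumes "mckay_quiver m H n S Q" "i < n" "g \<in> H" "g \<in> carrier_mat m m"
    and S: "\<And>j. j < n \<Longrightarrow> act (S j) g \<in> carrier_mat (deg (S j)) (deg (S j))"
  shows "mat_trace g * mat_trace (act (S i) g) =
    (\<Sum>j<n. of_nat (card {e \<in> arcs Q. tail Q e = i \<and> head Q e = j}) * mat_trace (act (S j) g))"
proof -
  let ?a = "\<lambda>j. card {e \<in> arcs Q. tail Q e = i \<and> head Q e = j}"
  have "rep_iso H (tensor_rep (natural_rep m) (S i)) (sum_rep n ?a S)"
    using assms by (auto simp: mckay_quiver_def)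
  then have "mat_trace (act (tensor_rep (natural_rep m) (S i)) g) = mat_trace (act (sum_rep n ?a S) g)"
    using assms kronecker_carrier[OF assms(4) S]
    by (intro rep_iso_trace[OF _ assms(3)] sum_rep_carrier) (auto simp: tensor_rep_def natural_rep_def)
  then show ?thesis
    using mat_trace_kronecker[OF assms(4) S[OF assms(2)]] S
    by (simp add: sum_rep_trace tensor_rep_def natural_rep_def)
qed

text \<open>The upper left block recovers \<open>g\<close>. Injectivity lets \<open>inv_into\<close>
  in \<open>transport_rep\<close> undo the embedding.\<close>

lemma inj_on_gl_embed: "inj_on (gl_embed m) (carrier_mat m m)"
proof (rule inj_onI)
  fix g h :: "complex mat" assume g: "g \<in> carrier_mat m m" and h: "h \<in> carrier_mat m m"
    and eq: "gl_embed m g = gl_embed m h"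
  show "g = h"
  proof (rule eq_matI)
    fix i j assume "i < dim_row h" "j < dim_col h"
    then have "gl_embed m g $$ (i, j) = g $$ (i, j)" "gl_embed m h $$ (i, j) = h $$ (i, j)"
      using g h by (auto simp: gl_embed_def)
    then show "g $$ (i, j) = h $$ (i, j)" using eq by simp
  qed (use g h in auto)
qed

lemma gl_embed_trace:
  assumes "g \<in> carrier_mat m m"
  shows "mat_trace (gl_embed m g) = mat_trace g + inverse (det g)"
  unfolding gl_embed_def
  by (subst mat_trace_four_block[OF assms]) (auto simp: mat_trace_def)

lemma gl_embed_carrier:
  "g \<in> carrier_mat m m \<Longrightarrow> gl_embed m g \<in> carrier_mat (m + 1) (m + 1)"
  by (auto simp: gl_embed_def)

theorem theorem3p1:
  fixes m n :: nat
    and G' G :: "complex mat set"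
    and S :: "nat \<Rightarrow> complex mat rep"
    and \<sigma> :: "nat \<Rightarrow> nat"
    and Q' :: "(nat, 'a) pre_digraph"
    and Q :: "(nat, 'b) pre_digraph"
  assumes "1 \<le> m"
    and "finite G'" and "subgroup G' (GL m)"
    and G: "G = gl_embed m ` G'"
    and "irrep_representatives (GL_sub m G') n S"
    and "mckay_quiver m G' n S Q'"
    and "mckay_quiver (m + 1) G n (\<lambda>i. transport_rep (gl_embed m) G' (S i)) Q"
    and "nakayama_translation (ext_skew_algebra m G') n (\<lambda>i. inflate G' (S i)) \<sigma>"
  shows "quiver_iso_over_verts (add_arrows \<sigma> Q') Q"
proof -
  interpret finite_matrix_group m G' using assms(2,3) by (rule finite_matrix_group.intro)
  let ?\<chi> = "\<lambda>j g. mat_trace (act (S j) g)"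
  let ?a' = "\<lambda>i j. card {e \<in> arcs Q'. tail Q' e = i \<and> head Q' e = j}"
  let ?a = "\<lambda>i j. card {e \<in> arcs Q. tail Q e = i \<and> head Q e = j}"
  have S: "group_rep (GL_sub m G') (S j)" "simple_rep G' (S j)" if "j < n" for j
    using assms(5) that by (simp_all add: irrep_representatives_def)
  have \<sigma>: "bij_betw \<sigma> {..<n} {..<n}" using assms(8) by (simp add: nakayama_translation_def)
  have nakayama: "?\<chi> (\<sigma> j) g = det g * ?\<chi> j g" if j: "j < n" and g: "g \<in> G'" for j g
  proof -
    have "\<sigma> j < n" using \<sigma> j by (auto simp: bij_betw_def)
    moreover obtain P \<pi> where "projective_cover (ext_skew_algebra m G') P \<pi> (inflate G' (S j))"
      "socle_iso (ext_skew_algebra m G') P (inflate G' (S (\<sigma> j)))"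
      using assms(8) j by (auto simp: nakayama_translation_def)
    ultimately show ?thesis using S j g by (intro socle_projective_cover) auto
  qed
  have a': "mat_trace g * ?\<chi> i g = (\<Sum>j<n. of_nat (?a' i j) * ?\<chi> j g)" if "i < n" "g \<in> G'" for i g
    using assms(6) that rep_mat[OF S(1)] by (intro mckay_quiver_character) auto
  have a: "(mat_trace g + inverse (det g)) * ?\<chi> i g = (\<Sum>j<n. of_nat (?a i j) * ?\<chi> j g)"
    if i: "i < n" and g: "g \<in> G'" for i g
  proof -
    let ?T = "\<lambda>i. transport_rep (gl_embed m) G' (S i)"
    have "inj_on (gl_embed m) G'" using inj_on_gl_embed by (rule inj_on_subset) auto
    then have act: "act (?T j) (gl_embed m g) = act (S j) g" for j
      using g by (simp add: transport_rep_def inv_into_f_f)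
    have "mat_trace (gl_embed m g) * mat_trace (act (?T i) (gl_embed m g)) =
        (\<Sum>j<n. of_nat (?a i j) * mat_trace (act (?T j) (gl_embed m g)))"
    proof (rule mckay_quiver_character[OF assms(7) i])
      show "gl_embed m g \<in> G" using g G by simp
      show "gl_embed m g \<in> carrier_mat (m + 1) (m + 1)" using g by (intro gl_embed_carrier) simp
      show "act (?T j) (gl_embed m g) \<in> carrier_mat (deg (?T j)) (deg (?T j))" if "j < n" for j
        unfolding act using rep_mat[OF S(1)[OF that] g] by (simp add: transport_rep_def)
    qed
    then show ?thesis using g by (simp add: act gl_embed_trace)
  qed
  have count: "?a i j = ?a' i j + (if \<sigma> j = i then 1 else 0)" if i: "i < n" and j: "j < n" for i j
  proof -
    \<comment> \<open>The vertex \<open>k\<close> with \<open>\<sigma> k = i\<close> is the end of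
      the one additional arrow that starts at \<open>i\<close>.\<close>
    have "i \<in> \<sigma> ` {..<n}" unfolding bij_betw_imp_surj_on[OF \<sigma>] using i by simp
    then obtain k where k: "k < n" "\<sigma> k = i" by auto
    \<comment> \<open>The claimed difference of arrow numbers, as coefficients of characters. They
      vanish if \<open>inverse (det g)\<close> times the character of \<open>S i\<close> is the
      character of \<open>S k\<close>, which is the relation \<open>nakayama\<close> at
      \<open>k\<close>.\<close>
    let ?c = "\<lambda>j. of_nat (?a i j) - of_nat (?a' i j) - (if j = k then 1 else 0) :: complex"
    have "(\<Sum>j<n. ?c j * ?\<chi> j g) = 0" if g: "g \<in> G'" for g
    proof -
      have "(\<Sum>j<n. (if j = k then 1 else 0) * ?\<chi> j g) = (\<Sum>j<n. if j = k then ?\<chi> k g else 0)"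
        by (intro sum.cong) auto
      also have "\<dots> = ?\<chi> k g" using k(1) by simp
      finally have "(\<Sum>j<n. ?c j * ?\<chi> j g) =
          (mat_trace g + inverse (det g)) * ?\<chi> i g - mat_trace g * ?\<chi> i g - ?\<chi> k g"
        by (simp only: a[OF i g] a'[OF i g] left_diff_distrib sum_subtractf)
      also have "\<dots> = inverse (det g) * ?\<chi> i g - ?\<chi> k g" by (simp add: distrib_right)
      also have "\<dots> = 0" using nakayama[OF k(1) g] k(2) det_nonzero[OF g] by (simp add: field_simps)
      finally show ?thesis .
    qed
    then have "?c j = 0"
      using characters_independent[of n S ?c j] S assms(5) j by (auto simp: irrep_representatives_def)
    \<comment> \<open>The equation is rearranged without subtraction before it is brought back to
      natural numbers.\<close>
    then have "of_nat (?a i j) = (of_nat (?a' i j + (if j = k then 1 else 0)) :: complex)"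
      by (auto simp: algebra_simps split: if_splits)
    then have "?a i j = ?a' i j + (if j = k then 1 else 0)" by (simp only: of_nat_eq_iff)
    moreover have "j = k \<longleftrightarrow> \<sigma> j = i" using \<sigma> j k by (auto simp: bij_betw_def inj_on_def)
    ultimately show ?thesis by simp
  qed
  have Q': "fin_digraph Q'" "verts Q' = {..<n}" and Q: "fin_digraph Q" "verts Q = {..<n}"
    using assms(6,7) by (simp_all add: mckay_quiver_def)
  show ?thesis
  proof (rule quiver_iso_over_verts_if_card_eq)
    show "fin_digraph (add_arrows \<sigma> Q')"
      using \<sigma> Q' by (intro fin_digraph_add_arrows) (auto simp: bij_betw_def)
    show "verts Q = verts (add_arrows \<sigma> Q')" using Q Q' by (simp add: add_arrows_def)
    show "card {e \<in> arcs (add_arrows \<sigma> Q'). tail (add_arrows \<sigma> Q') e = v \<and> head (add_arrows \<sigma> Q') e = w} =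
        card {e \<in> arcs Q. tail Q e = v \<and> head Q e = w}"
      if "v \<in> verts (add_arrows \<sigma> Q')" "w \<in> verts (add_arrows \<sigma> Q')" for v w
    proof -
      have "v < n" "w < n" using that Q'(2) by (simp_all add: add_arrows_def)
      then show ?thesis using Q' by (simp add: card_add_arrows count)
    qed
  qed (rule Q)
qed

end
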